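(* Let $(X,d)$ be a compact metric space and let $\phi$ be a continuous flow on $X$. If there exists a point $x\in\Omega(\phi)\setminus Crit(\phi)$ which is strongly-shadowable and uniformly-expansive, then there exists a closed $\phi$-invariant set $Y\subset X$ such that $\phi|_Y$ is conjugate to a suspension flow of a subshift with positive entropy.
   Context: A continuous flow on $X$ is a continuous map $\phi:\mathbb{R}\times X\to X$, $\phi^t(x)=\phi(t,x)$, with $\phi^0=\mathrm{id}$ and $\phi^{t+s}=\phi^s\circ\phi^t$; $O(x)=\{\phi^t(x):t\in\mathbb{R}\}$. A point $x$ is periodic if there is $T>0$ with $\phi^{t+T}(x)=\phi^t(x)$ for all $t$; its period $\pi(x)$ is the infimum of such $T\ge0$, and $x$ is a singularity if $\pi(x)=0$. $Sing(\phi)$ and $Per(\phi)$ denote the sets of singularities and periodic points, and $Crit(\phi)=Sing(\phi)\cup Per(\phi)$. $x$ is wandering if there are a neighborhood $U$ of $x$ and $T>0$ with $\phi^t(x)\notin U$ for all $t\ge T$; $\Omega(\phi)$ is the set of non-wandering points. A reparametrization is an increasing homeomorphism $h:\mathbb{R}\to\mathbb{R}$ with $h(0)=0$; $Rep_\varepsilon(\phi)$ is the set of those with $\left|\frac{h(x)-h(y)}{x-y}-1\right|\le\varepsilon$ for all $x\ne y$. A sequence $(x_i,t_i)_{i=a}^b$ is a $(\delta,T)$-pseudo-orbit if $t_i\ge T$ and $d(\phi^{t_i}(x_i),x_{i+1})<\delta$ for all $i$. Put $s_i=\sum_{n=0}^{i-1}t_n$ for $i\ge0$, $s_i=-\sum_{n=i}^{-1}t_n$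 for $i<0$. It is $\varepsilon$-strongly-shadowed if there are $y\in X$ and $h\in Rep_\varepsilon(\phi)$ with $d(\phi^{h(t)}(y),\phi^{t-s_i}(x_i))<\varepsilon$ for all $i$ and $s_i\le t\le s_{i+1}$. A point $x$ is strongly-shadowable if for every $\varepsilon>0$ there is $\delta>0$ such that every $(\delta,1)$-pseudo-orbit $(x_i,t_i)$ with $x_0=x$ is $\varepsilon$-strongly-shadowed. A point $x$ is uniformly-expansive if there is a neighborhood $U$ of $x$ such that for every $\varepsilon>0$ there is $\delta>0$ such that whenever $y,z\in U$ and some reparametrization $h$ satisfies $d(\phi^t(y),\phi^{h(t)}(z))<\delta$ for all $t\in\mathbb{R}$, then $y=\phi^t(w)$ with $w\in O(z)$ and $|t|<\varepsilon$. A subshift is a closed shift-invariant subset of $\mathcal{A}^{\mathbb{Z}}$ ($\mathcal{A}$ finite) with the shift map. Given a homeomorphism $f$ of a compact metric space $Z$ and continuous $r:Z\to(0,\infty)$, the suspension flow with roof $r$ is the flow on $\{(z,t):0\le t\le r(z)\}/(z,r(z))\sim(f(z),0)$ induced by translation in the second coordinate. Conjugate means there is a homeomorphism intertwining the flows. *)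

theory Defs
  imports "HOL-Analysis.Analysis"
begin

section \<open>Continuous flows\<close>

text \<open>A continuous flow on the (compact metric) space given by the type 'a.\<close>
definition is_flow :: "(real \<Rightarrow> 'a::topological_space \<Rightarrow> 'a) \<Rightarrow> bool" where
  "is_flow \<phi> \<longleftrightarrow> continuous_on UNIV (\<lambda>p. \<phi> (fst p) (snd p)) \<and>
     \<phi> 0 = id \<and> (\<forall>t s. \<phi> (t + s) = \<phi> s \<circ> \<phi> t)"

definition orbit :: "(real \<Rightarrow> 'a \<Rightarrow> 'a) \<Rightarrow> 'a \<Rightarrow> 'a set" where
  "orbit \<phi> x = {\<phi> t x | t. True}"

definition Per :: "(real \<Rightarrow> 'a \<Rightarrow> 'a) \<Rightarrow> 'a set" where
  "Per \<phi> = {x. \<exists>T>0. \<forall>t. \<phi> (t + T) x = \<phi> t x}"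

definition period :: "(real \<Rightarrow> 'a \<Rightarrow> 'a) \<Rightarrow> 'a \<Rightarrow> real" where
  "period \<phi> x = Inf {T. T \<ge> 0 \<and> (\<forall>t. \<phi> (t + T) x = \<phi> t x)}"

definition Sing :: "(real \<Rightarrow> 'a \<Rightarrow> 'a) \<Rightarrow> 'a set" where
  "Sing \<phi> = {x \<in> Per \<phi>. period \<phi> x = 0}"

definition Crit :: "(real \<Rightarrow> 'a \<Rightarrow> 'a) \<Rightarrow> 'a set" where
  "Crit \<phi> = Sing \<phi> \<union> Per \<phi>"

definition wandering :: "(real \<Rightarrow> 'a::topological_space \<Rightarrow> 'a) \<Rightarrow> 'a \<Rightarrow> bool" where
  "wandering \<phi> x \<longleftrightarrow> (\<exists>U T. open U \<and> x \<in> U \<and> T > 0 \<and> (\<forall>t\<ge>T. \<phi> t x \<notin> U))"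

definition NonWandering :: "(real \<Rightarrow> 'a::topological_space \<Rightarrow> 'a) \<Rightarrow> 'a set" where
  "NonWandering \<phi> = {x. \<not> wandering \<phi> x}"

section \<open>Reparametrizations\<close>

definition reparam :: "(real \<Rightarrow> real) \<Rightarrow> bool" where
  "reparam h \<longleftrightarrow> strict_mono h \<and> (\<exists>g. homeomorphism UNIV UNIV h g) \<and> h 0 = 0"

definition Rep :: "real \<Rightarrow> (real \<Rightarrow> real) set" where
  "Rep \<epsilon> = {h. reparam h \<and> (\<forall>x y. x \<noteq> y \<longrightarrow> \<bar>(h x - h y) / (x - y) - 1\<bar> \<le> \<epsilon>)}"

section \<open>Pseudo-orbits and strong shadowing\<close>

text \<open>A pseudo-orbit is indexed by an integer interval I containing 0
  (finite, one-sided infinite or bi-infinite).\<close>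
definition int_interval0 :: "int set \<Rightarrow> bool" where
  "int_interval0 I \<longleftrightarrow> 0 \<in> I \<and> (\<forall>i j k. i \<in> I \<longrightarrow> k \<in> I \<longrightarrow> i \<le> j \<longrightarrow> j \<le> k \<longrightarrow> j \<in> I)"

definition pseudo_orbit ::
  "(real \<Rightarrow> 'a::metric_space \<Rightarrow> 'a) \<Rightarrow> real \<Rightarrow> real \<Rightarrow> int set \<Rightarrow> (int \<Rightarrow> 'a) \<Rightarrow> (int \<Rightarrow> real) \<Rightarrow> bool"
  where
  "pseudo_orbit \<phi> \<delta> T I xs ts \<longleftrightarrow> int_interval0 I \<and>
     (\<forall>i\<in>I. ts i \<ge> T) \<and>
     (\<forall>i. i \<in> I \<longrightarrow> i + 1 \<in> I \<longrightarrow> dist (\<phi> (ts i) (xs i)) (xs (i + 1)) < \<delta>)"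

definition ssum :: "(int \<Rightarrow> real) \<Rightarrow> int \<Rightarrow> real" where
  "ssum ts i = (if i \<ge> 0 then (\<Sum>n\<in>{0..<i}. ts n) else - (\<Sum>n\<in>{i..<0}. ts n))"

definition strongly_shadowed ::
  "(real \<Rightarrow> 'a::metric_space \<Rightarrow> 'a) \<Rightarrow> real \<Rightarrow> int set \<Rightarrow> (int \<Rightarrow> 'a) \<Rightarrow> (int \<Rightarrow> real) \<Rightarrow> bool"
  where
  "strongly_shadowed \<phi> \<epsilon> I xs ts \<longleftrightarrow> (\<exists>y h. h \<in> Rep \<epsilon> \<and>
     (\<forall>i\<in>I. \<forall>t. ssum ts i \<le> t \<and> t \<le> ssum ts (i + 1) \<longrightarrow>
        dist (\<phi> (h t) y) (\<phi> (t - ssum ts i) (xs i)) < \<epsilon>))"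

definition strongly_shadowable :: "(real \<Rightarrow> 'a::metric_space \<Rightarrow> 'a) \<Rightarrow> 'a \<Rightarrow> bool" where
  "strongly_shadowable \<phi> x \<longleftrightarrow> (\<forall>\<epsilon>>0. \<exists>\<delta>>0. \<forall>I xs ts.
     pseudo_orbit \<phi> \<delta> 1 I xs ts \<and> xs 0 = x \<longrightarrow> strongly_shadowed \<phi> \<epsilon> I xs ts)"

section \<open>Uniform expansivity\<close>

definition uniformly_expansive :: "(real \<Rightarrow> 'a::metric_space \<Rightarrow> 'a) \<Rightarrow> 'a \<Rightarrow> bool" where
  "uniformly_expansive \<phi> x \<longleftrightarrow> (\<exists>U. open U \<and> x \<in> U \<and>
     (\<forall>\<epsilon>>0. \<exists>\<delta>>0. \<forall>y z h. y \<in> U \<and> z \<in> U \<and> reparam h \<and>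
        (\<forall>t. dist (\<phi> t y) (\<phi> (h t) z) < \<delta>) \<longrightarrow>
        (\<exists>w\<in>orbit \<phi> z. \<exists>t. \<bar>t\<bar> < \<epsilon> \<and> y = \<phi> t w)))"

section \<open>Subshifts and their entropy\<close>

text \<open>Sequences over the alphabet are maps int => nat; the alphabet is a finite set of
  naturals; the topology on int => nat is the product topology (nat discrete).\<close>

definition shiftn :: "int \<Rightarrow> (int \<Rightarrow> nat) \<Rightarrow> (int \<Rightarrow> nat)" where
  "shiftn k \<omega> = (\<lambda>i. \<omega> (i + k))"

definition shift :: "(int \<Rightarrow> nat) \<Rightarrow> (int \<Rightarrow> nat)" where
  "shift = shiftn 1"

definition subshift :: "nat set \<Rightarrow> (int \<Rightarrow> nat) set \<Rightarrow> bool" where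
  "subshift A \<Sigma> \<longleftrightarrow> finite A \<and> (\<forall>\<omega>\<in>\<Sigma>. \<forall>i. \<omega> i \<in> A) \<and> closed \<Sigma> \<and> shift ` \<Sigma> = \<Sigma>"

definition words :: "nat \<Rightarrow> (int \<Rightarrow> nat) set \<Rightarrow> nat list set" where
  "words n \<Sigma> = (\<lambda>\<omega>. map (\<lambda>k. \<omega> (int k)) [0..<n]) ` \<Sigma>"

text \<open>Topological entropy of the shift on a subshift: lim (1/n) log #(words of length n).\<close>
definition subshift_entropy :: "(int \<Rightarrow> nat) set \<Rightarrow> real" where
  "subshift_entropy \<Sigma> = lim (\<lambda>n. ln (real (card (words (Suc n) \<Sigma>))) / real (Suc n))"

section \<open>Suspension flows\<close>

text \<open>Quotient topology on the set of equivalence classes of R on the carrier of T.\<close>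
definition quotient_topology :: "'a topology \<Rightarrow> ('a \<times> 'a) set \<Rightarrow> 'a set topology" where
  "quotient_topology T R = topology (\<lambda>U. U \<subseteq> topspace T // R \<and> openin T (\<Union>U))"

definition susp_dom :: "(int \<Rightarrow> nat) set \<Rightarrow> ((int \<Rightarrow> nat) \<Rightarrow> real) \<Rightarrow> ((int \<Rightarrow> nat) \<times> real) set" where
  "susp_dom \<Sigma> r = {(z, s). z \<in> \<Sigma> \<and> 0 \<le> s \<and> s \<le> r z}"

text \<open>The smallest equivalence relation on the domain with (z, r z) ~ (shift z, 0).\<close>
definition susp_rel :: "(int \<Rightarrow> nat) set \<Rightarrow> ((int \<Rightarrow> nat) \<Rightarrow> real) \<Rightarrow>
    (((int \<Rightarrow> nat) \<times> real) \<times> ((int \<Rightarrow> nat) \<times> real)) set" where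
  "susp_rel \<Sigma> r =
     (let P = {((z, r z), (shift z, 0)) | z. z \<in> \<Sigma>} in (P \<union> P\<inverse>)\<^sup>*) \<inter> (susp_dom \<Sigma> r \<times> susp_dom \<Sigma> r)"

definition susp_space :: "(int \<Rightarrow> nat) set \<Rightarrow> ((int \<Rightarrow> nat) \<Rightarrow> real) \<Rightarrow> ((int \<Rightarrow> nat) \<times> real) set topology" where
  "susp_space \<Sigma> r = quotient_topology (subtopology euclidean (susp_dom \<Sigma> r)) (susp_rel \<Sigma> r)"

text \<open>Birkhoff sums of the roof function along the shift.\<close>
definition roof_sum :: "((int \<Rightarrow> nat) \<Rightarrow> real) \<Rightarrow> (int \<Rightarrow> nat) \<Rightarrow> int \<Rightarrow> real" where
  "roof_sum r z n = (if n \<ge> 0 then (\<Sum>k\<in>{0..<n}. r (shiftn k z)) else - (\<Sum>k\<in>{n..<0}. r (shiftn k z)))"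

text \<open>The suspension flow: translation in the second coordinate, passing through the
  identifications (z, r z) ~ (shift z, 0).\<close>
definition susp_flow :: "(int \<Rightarrow> nat) set \<Rightarrow> ((int \<Rightarrow> nat) \<Rightarrow> real) \<Rightarrow> real \<Rightarrow>
    ((int \<Rightarrow> nat) \<times> real) set \<Rightarrow> ((int \<Rightarrow> nat) \<times> real) set" where
  "susp_flow \<Sigma> r t c = \<Union>{susp_rel \<Sigma> r `` {(shiftn n z, s + t - roof_sum r z n)} | z s n.
       (z, s) \<in> c \<and> roof_sum r z n \<le> s + t \<and> s + t < roof_sum r z (n + 1)}"

text \<open>phi restricted to the closed invariant set Y is conjugate to the suspension flow
  over the subshift Sigma with roof r.\<close>
definition conj_to_suspension :: "(real \<Rightarrow> 'a::topological_space \<Rightarrow> 'a) \<Rightarrow> 'a set \<Rightarrow>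
    (int \<Rightarrow> nat) set \<Rightarrow> ((int \<Rightarrow> nat) \<Rightarrow> real) \<Rightarrow> bool" where
  "conj_to_suspension \<phi> Y \<Sigma> r \<longleftrightarrow> (\<exists>H.
     homeomorphic_map (susp_space \<Sigma> r) (subtopology euclidean Y) H \<and>
     (\<forall>t. \<forall>c\<in>topspace (susp_space \<Sigma> r). H (susp_flow \<Sigma> r t c) = \<phi> t (H c)))"

end

theory Submission
  imports Defs "HOL-Computational_Algebra.Primes"
begin

text \<open>With this definition of wandering, a nonwandering \<open>x\<close> is forward recurrent.  Closing up a return of \<open>x\<close>
  gives a periodic pseudo-orbit; expansivity puts all its shadowing points on one orbit, which is then
  compact, hence (Baire) a periodic orbit of some \<open>p\<close>.  Since \<open>x\<close> is recurrent and not periodic, a long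
  orbit segment of \<open>x\<close> starting and ending near \<open>x\<close> does not follow the orbit of \<open>p\<close>.  Alternating this
  segment with runs along \<open>p\<close> of four different lengths gives a pseudo-orbit for every sequence over four
  symbols.  In any orbit shadowing such a pseudo-orbit the segments of \<open>x\<close> are visible up to a bounded
  time error, so the orbit determines the sequence up to a shift.  Expansivity here only says that two
  points shadowing the same sequence lie on the same orbit; restricting to a subshift without periodic
  sequences turns this into a bound on the time between them.  A canonical choice among these points
  then gives a continuous cross-section homeomorphic to the subshift.\<close>

subsection \<open>Compactness in function spaces\<close>

text \<open>In \<open>uniformly_expansive\<close> the point \<open>w\<close> ranges over the whole
  orbit of \<open>z\<close>, so expansivity yields \<open>y \<in> orbit \<phi> z\<close> without
  bounding the time between \<open>y\<close> and \<open>z\<close>; such bounds have to be won by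
  coding. The other obstacle is drift: a shadowing reparametrization only has slopes close to 1, so
  its error may grow linearly, and two followers of the same sequence cannot be compared by their
  clocks at large times. Markers reset the clock: each visible copy of the \<open>x\<close>-segment
  fixes the time up to \<open>2 * b\<close>, and only the length of a single block has to be read
  off. With slopes between 4/5 and 5/4 the clocks of two followers differ at most by the factor
  25/16, and since this is less than 2, runs along \<open>p\<close> whose lengths at least double
  can be told apart. Periodic sequences must be avoided because an orbit following one may meet
  points that code the same sequence once per period, hence arbitrarily far apart in time.\<close>

lemma compact_fun_box:
  fixes B :: "'i \<Rightarrow> 'b::topological_space set"
  assumes "\<And>i. compact (B i)"
  shows "compact {f. \<forall>i. f i \<in> B i}"
proof -
  have "compactin (product_topology (\<lambda>i. euclidean) UNIV) (PiE UNIV B)"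
    using assms by (simp add: compactin_PiE)
  moreover have "PiE UNIV B = {f. \<forall>i. f i \<in> B i}" by auto
  ultimately show ?thesis by (simp add: euclidean_product_topology)
qed

text \<open>The preimage of a closed set \<open>B\<close> is the projection of the part of the graph
  in \<open>UNIV \<times> B\<close>, hence compact. The cross-section and its return time are
  defined by choice and by description, so their continuity is reached through their graphs.\<close>

lemma continuous_on_compact_graph:
  fixes f :: "'a::topological_space \<Rightarrow> 'b::topological_space"
  assumes "Hausdorff_space (euclidean :: 'a topology)" "compact {(x, f x) | x. x \<in> S}"
  shows "continuous_on S f"
  unfolding continuous_on_closed_invariant
proof (intro allI impI)
  fix B :: "'b set" assume "closed B"
  then have "compact ({(x, f x) | x. x \<in> S} \<inter> UNIV \<times> B)"
    using assms by (intro compact_Int_closed closed_Times) auto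
  then have "compact (fst ` ({(x, f x) | x. x \<in> S} \<inter> UNIV \<times> B))"
    by (intro compact_continuous_image continuous_intros)
  moreover have "fst ` ({(x, f x) | x. x \<in> S} \<inter> UNIV \<times> B) = f -` B \<inter> S" by force
  ultimately have "closed (f -` B \<inter> S)"
    using compactin_imp_closedin[OF assms(1)] by simp
  then show "\<exists>A. closed A \<and> A \<inter> S = f -` B \<inter> S" by (metis Int_assoc Int_absorb)
qed

lemma Hausdorff_sequences: "Hausdorff_space (euclidean :: ('i \<Rightarrow> nat) topology)"
proof -
  have "Hausdorff_space (euclidean :: nat topology)"
    unfolding Hausdorff_space_def
  proof (intro allI impI, elim conjE)
    fix m n :: nat assume "m \<noteq> n"
    then have "openin euclidean {m} \<and> openin euclidean {n} \<and> m \<in> {m} \<and> n \<in> {n} \<and> disjnt {m} {n}"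
      by (auto simp: disjnt_def open_discrete)
    then show "\<exists>U V. openin euclidean U \<and> openin euclidean V \<and> m \<in> U \<and> n \<in> V \<and> disjnt U V"
      by blast
  qed
  then show ?thesis unfolding euclidean_product_topology[symmetric] by (simp add: Hausdorff_space_product_topology)
qed

lemma closed_imp_Collect:
  assumes "open {z. P z}" "closed {z. Q z}"
  shows "closed {z. P z \<longrightarrow> Q z}"
proof -
  have "{z. P z \<longrightarrow> Q z} = - {z. P z} \<union> {z. Q z}" by auto
  then show ?thesis using assms by auto
qed

subsection \<open>Bi-Lipschitz time changes\<close>

text \<open>Unlike \<open>Rep\<close>, this class is stable under inversion, with the same constant,
  and under composition, with the product of the constants. The condition is closed under pointwise
  limits, and as no value at 0 is prescribed it survives translation.\<close>

definition time_change :: "real \<Rightarrow> (real \<Rightarrow> real) \<Rightarrow> bool" where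
  "time_change c k \<longleftrightarrow> (\<forall>s t. s \<le> t \<longrightarrow> (t - s) / c \<le> k t - k s \<and> k t - k s \<le> c * (t - s))"

lemma time_changeD:
  assumes "time_change c k" "s \<le> t"
  shows "(t - s) / c \<le> k t - k s" "k t - k s \<le> c * (t - s)"
  using assms by (auto simp: time_change_def)

lemma time_change_translate: "time_change c k \<Longrightarrow> time_change c (\<lambda>t. k (t + u) - v)"
  unfolding time_change_def by (smt (verit))

lemma time_change_less:
  assumes "time_change c k" "c > 0" "s < t"
  shows "k s < k t"
  using time_changeD(1)[OF assms(1), of s t] assms by (smt (verit) divide_pos_pos)

lemma time_change_less_iff: "time_change c k \<Longrightarrow> c > 0 \<Longrightarrow> k s < k t \<longleftrightarrow> s < t"
  by (metis time_change_less less_linear order_less_imp_not_less)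

lemma time_change_le_iff: "time_change c k \<Longrightarrow> c > 0 \<Longrightarrow> k s \<le> k t \<longleftrightarrow> s \<le> t"
  by (meson time_change_less_iff not_less)

lemma time_change_strict_mono: "time_change c k \<Longrightarrow> c > 0 \<Longrightarrow> strict_mono k"
  by (simp add: strict_mono_def time_change_less)

lemma time_change_continuous:
  assumes "time_change c k" "c > 0"
  shows "continuous_on S k"
proof -
  have "c-lipschitz_on UNIV k"
  proof (rule lipschitz_onI)
    fix s t :: real
    show "dist (k s) (k t) \<le> c * dist s t"
      using time_changeD(2)[OF assms(1), of s t] time_changeD(2)[OF assms(1), of t s]
        time_change_le_iff[OF assms, of s t] time_change_le_iff[OF assms, of t s]
      by (cases "s \<le> t") (auto simp: dist_real_def)
  qed (use assms in simp)
  then show ?thesis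
    using lipschitz_on_continuous_on continuous_on_subset by blast
qed

lemma time_change_surj:
  assumes "time_change c k" "c > 0"
  shows "surj k"
proof -
  have "\<exists>t. k t = v" for v
  proof -
    define T where "T = c * (\<bar>v\<bar> + \<bar>k 0\<bar>)"
    have T: "T \<ge> 0" "T / c = \<bar>v\<bar> + \<bar>k 0\<bar>" using assms by (auto simp: T_def)
    have "k (-T) \<le> v" using time_changeD(1)[OF assms(1), of "-T" 0] T by auto
    moreover have "v \<le> k T" using time_changeD(1)[OF assms(1), of 0 T] T by auto
    ultimately show ?thesis
      using IVT'[of k "-T" v T] T time_change_continuous[OF assms] by force
  qed
  then show ?thesis by (metis surj_def)
qed

lemma time_change_inv:
  assumes "time_change c k" "c > 0"
  shows "time_change c (inv k)" "k (inv k t) = t" "inv k (k t) = t"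
proof -
  show r: "k (inv k t) = t" for t using time_change_surj[OF assms] by (simp add: surj_f_inv_f)
  show "inv k (k t) = t" for t
    using time_change_strict_mono[OF assms] by (simp add: strict_mono_imp_inj_on)
  show "time_change c (inv k)"
    unfolding time_change_def
  proof (intro allI impI)
    fix s t :: real assume "s \<le> t"
    then have "inv k s \<le> inv k t" using time_change_le_iff[OF assms, of "inv k s" "inv k t"] r by simp
    from time_changeD[OF assms(1) this] r assms(2)
    show "(t - s) / c \<le> inv k t - inv k s \<and> inv k t - inv k s \<le> c * (t - s)"
      by (auto simp: field_simps)
  qed
qed

lemma time_change_compose:
  assumes "time_change c k" "time_change d l" "c > 0" "d > 0"
  shows "time_change (c * d) (\<lambda>t. k (l t))"
  unfolding time_change_def
proof (intro allI impI)
  fix s t :: real assume st: "s \<le> t"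
  have l: "l s \<le> l t" using st time_change_le_iff[OF assms(2,4)] by simp
  have "(t - s) / (c * d) = ((t - s) / d) / c" by (simp add: field_simps)
  also have "\<dots> \<le> (l t - l s) / c"
    using time_changeD(1)[OF assms(2) st] assms by (intro divide_right_mono) auto
  also have "\<dots> \<le> k (l t) - k (l s)" using time_changeD(1)[OF assms(1) l] .
  finally have 1: "(t - s) / (c * d) \<le> k (l t) - k (l s)" .
  have "k (l t) - k (l s) \<le> c * (l t - l s)" using time_changeD(2)[OF assms(1) l] .
  also have "\<dots> \<le> c * (d * (t - s))"
    using time_changeD(2)[OF assms(2) st] assms by (intro mult_left_mono) auto
  finally show "(t - s) / (c * d) \<le> k (l t) - k (l s) \<and> k (l t) - k (l s) \<le> c * d * (t - s)"
    using 1 by (simp add: mult.assoc)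
qed

lemma time_change_reparam:
  assumes "time_change c k" "c > 0" "k 0 = 0"
  shows "reparam k"
proof -
  have "homeomorphism UNIV UNIV k (inv k)"
    using time_change_inv[OF assms(1,2)] time_change_continuous[OF assms(1,2)]
      time_change_continuous[OF time_change_inv(1)[OF assms(1,2)] assms(2)] time_change_surj[OF assms(1,2)]
      time_change_surj[OF time_change_inv(1)[OF assms(1,2)] assms(2)]
    by (auto simp: homeomorphism_def)
  then show ?thesis using assms time_change_strict_mono by (auto simp: reparam_def)
qed

text \<open>The slopes of \<open>h\<close> lie between 4/5 and 6/5, those of its inverse between 5/6
  and 5/4; the symmetric constant 5/4 covers both ends.\<close>

lemma Rep_inverse:
  assumes "h \<in> Rep e" "e \<le> 1/5"
  obtains k where "time_change (5/4) k" "k 0 = 0" "\<And>t. h (k t) = t"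
proof -
  obtain k where hom: "homeomorphism UNIV UNIV h k" and h: "strict_mono h" "h 0 = 0"
    using assms by (auto simp: Rep_def reparam_def)
  have hk: "h (k t) = t" and kh: "k (h t) = t" for t
    using hom by (auto simp: homeomorphism_def)
  have "time_change (5/4) k"
    unfolding time_change_def
  proof (intro allI impI)
    fix s t :: real assume "s \<le> t"
    show "(t - s) / (5/4) \<le> k t - k s \<and> k t - k s \<le> 5/4 * (t - s)"
    proof (cases "s = t")
      case False
      then have lt: "k s < k t"
        using \<open>s \<le> t\<close> hk h(1) by (metis antisym not_le strict_mono_less)
      then have "\<bar>(h (k t) - h (k s)) / (k t - k s) - 1\<bar> \<le> e"
        using assms(1) by (auto simp: Rep_def)
      then have "\<bar>(t - s) / (k t - k s) - 1\<bar> \<le> 1/5" using assms(2) hk by simp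
      then have "(t - s) / (k t - k s) \<le> 6/5" "4/5 \<le> (t - s) / (k t - k s)" by linarith+
      then show ?thesis using lt by (simp add: field_simps)
    qed simp
  qed
  moreover have "k 0 = 0" using kh[of 0] h(2) by simp
  ultimately show ?thesis using that hk by blast
qed

text \<open>Tychonoff takes the place of Arzela-Ascoli: the Lipschitz bounds are closed conditions
  for pointwise convergence, and together with the range of \<open>k 0\<close> they confine each
  \<open>k t\<close> to a compact interval.\<close>

lemma compact_time_change:
  assumes "c > 0"
  shows "compact {k. time_change c k \<and> k 0 \<in> {lo..hi}}"
proof -
  have ev: "continuous_on UNIV (\<lambda>k::real\<Rightarrow>real. k t)" for t by simp
  define B where "B = {k. \<forall>t::real. k t \<in> {lo - c * \<bar>t\<bar>..hi + c * \<bar>t\<bar>}}"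
  define C where "C = (\<Inter>s. \<Inter>t. {k. s \<le> t \<longrightarrow> (t - s) / c \<le> k t - k s \<and> k t - k s \<le> c * (t - s)}) \<inter> {k. lo \<le> k 0 \<and> k 0 \<le> hi}"
  have "compact B" unfolding B_def by (rule compact_fun_box) auto
  moreover have "closed C" unfolding C_def
    by (intro closed_Int closed_INT ballI closed_imp_Collect closed_Collect_conj closed_Collect_le
         continuous_intros ev) auto
  ultimately have "compact (B \<inter> C)" by (rule compact_Int_closed)
  moreover have "B \<inter> C = {k. time_change c k \<and> k 0 \<in> {lo..hi}}"
  proof -
    have "k t \<in> {lo - c * \<bar>t\<bar>..hi + c * \<bar>t\<bar>}" if k: "time_change c k" "k 0 \<in> {lo..hi}" for k t
      using time_changeD(2)[OF k(1), of 0 t] time_changeD(2)[OF k(1), of t 0] time_change_le_iff[OF k(1) assms, of 0 t]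
        time_change_le_iff[OF k(1) assms, of t 0] k(2) by (cases "0 \<le> t") auto
    then show ?thesis by (auto simp: B_def C_def time_change_def)
  qed
  ultimately show ?thesis by simp
qed

subsection \<open>Partial sums\<close>

lemma ssum_0 [simp]: "ssum ts 0 = 0"
  by (simp add: ssum_def)

lemma ssum_step: "ssum ts (i + 1) = ssum ts i + ts i"
proof (cases "i \<ge> 0")
  case True
  then have "{0..<i + 1} = insert i {0..<i}" by auto
  then show ?thesis using True by (simp add: ssum_def)
next
  case False
  then have "{i..<0} = insert i {i + 1..<0}" by auto
  then show ?thesis using False by (cases "i = -1") (auto simp: ssum_def)
qed

lemma ssum_shift: "ssum (\<lambda>i. ts (i + n)) i = ssum ts (i + n) - ssum ts n"
proof (induction i rule: int_induct[where k = 0])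
  case (step1 i)
  then show ?case using ssum_step[of "\<lambda>i. ts (i + n)" i] ssum_step[of ts "i + n"]
    by (simp add: ac_simps)
next
  case (step2 i)
  then show ?case using ssum_step[of "\<lambda>i. ts (i + n)" "i - 1"] ssum_step[of ts "i - 1 + n"]
    by (simp add: ac_simps)
qed auto

lemma ssum_gap:
  assumes "\<And>i. ts i \<ge> g" "i \<le> j"
  shows "g * (j - i) \<le> ssum ts j - ssum ts i"
  using assms(2)
proof (induction j rule: int_ge_induct)
  case (step j)
  then show ?case using ssum_step[of ts j] assms(1)[of j] by (simp add: algebra_simps)
qed auto

lemma ssum_locate:
  assumes "\<And>i. ts i \<ge> g" "g > 0"
  obtains i where "ssum ts i \<le> v" "v < ssum ts (i + 1)"
proof -
  define m where "m = \<lceil>\<bar>v\<bar> / g\<rceil> + 1"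
  have m: "m \<ge> 0" "\<bar>v\<bar> / g < m"
    using ceiling_mono[of 0 "\<bar>v\<bar> / g"] assms(2) unfolding m_def by (simp, linarith)
  then have vm: "\<bar>v\<bar> < g * m" using assms(2) by (simp add: field_simps)
  have lo: "ssum ts (- m) \<le> v" using ssum_gap[of g ts "-m" 0] assms m vm by auto
  have hi: "v < ssum ts m" using ssum_gap[of g ts 0 m] assms m vm by auto
  define S where "S = {i. -m \<le> i \<and> i \<le> m \<and> ssum ts i \<le> v}"
  have "finite S" by (rule finite_subset[of _ "{-m..m}"]) (auto simp: S_def)
  have "-m \<in> S" using lo m by (auto simp: S_def)
  define i where "i = Max S"
  have "i \<in> S" using \<open>finite S\<close> \<open>-m \<in> S\<close> Max_in by (auto simp: i_def)
  moreover have "i + 1 \<notin> S" using Max_ge[OF \<open>finite S\<close>, of "i + 1"] by (auto simp: i_def)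
  ultimately have "ssum ts i \<le> v \<and> v < ssum ts (i + 1)"
    using hi by (cases "i = m") (auto simp: S_def)
  then show ?thesis using that by blast
qed

subsection \<open>Following a pseudo-orbit\<close>

text \<open>\<open>k\<close> is the inverse of a reparametrization: it turns time along the orbit of
  \<open>y\<close> into time along the pseudo-orbit, so that different followers can be compared.
  Strict inequalities in the premise and a weak one in the conclusion make the condition closed in
  \<open>ts\<close>, \<open>k\<close> and \<open>y\<close> jointly;
  \<open>follows_closed_interval\<close> recovers the endpoints.\<close>

definition follows :: "(real \<Rightarrow> 'a::metric_space \<Rightarrow> 'a) \<Rightarrow> real \<Rightarrow> (int \<Rightarrow> 'a) \<Rightarrow> (int \<Rightarrow> real) \<Rightarrow>
    (real \<Rightarrow> real) \<Rightarrow> 'a \<Rightarrow> bool" where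
  "follows \<phi> e xs ts k y \<longleftrightarrow> (\<forall>i t. ssum ts i < k t \<and> k t < ssum ts (i + 1) \<longrightarrow>
     dist (\<phi> t y) (\<phi> (k t - ssum ts i) (xs i)) \<le> e)"

lemma strongly_shadowed_follows:
  assumes "strongly_shadowed \<phi> e UNIV xs ts" "e \<le> 1/5"
  obtains y k where "time_change (5/4) k" "k 0 = 0" "follows \<phi> e xs ts k y"
proof -
  obtain y h where h: "h \<in> Rep e"
    and sh: "\<And>i t. ssum ts i \<le> t \<Longrightarrow> t \<le> ssum ts (i + 1) \<Longrightarrow>
        dist (\<phi> (h t) y) (\<phi> (t - ssum ts i) (xs i)) < e"
    using assms(1) by (auto simp: strongly_shadowed_def)
  obtain k where k: "time_change (5/4) k" "k 0 = 0" "\<And>t. h (k t) = t"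
    using Rep_inverse[OF h assms(2)] by blast
  have "follows \<phi> e xs ts k y"
    unfolding follows_def using sh[of _ "k _"] k(3) by (metis less_imp_le)
  with k that show ?thesis by blast
qed

section \<open>Continuous flows on a compact space\<close>

locale compact_flow =
  fixes \<phi> :: "real \<Rightarrow> 'a::metric_space \<Rightarrow> 'a"
  assumes compact_UNIV: "compact (UNIV :: 'a set)"
    and flow: "is_flow \<phi>"
begin

lemma flow_0 [simp]: "\<phi> 0 y = y"
  using flow by (simp add: is_flow_def)

lemma flow_add: "\<phi> s (\<phi> t y) = \<phi> (t + s) y"
  using flow by (simp add: is_flow_def)

lemma continuous_on_flow [continuous_intros]:
  assumes "continuous_on S f" "continuous_on S g"
  shows "continuous_on S (\<lambda>z. \<phi> (f z) (g z))"
proof -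
  have "continuous_on UNIV (\<lambda>p. \<phi> (fst p) (snd p))" using flow by (simp add: is_flow_def)
  from continuous_on_compose2[OF this, of S "\<lambda>z. (f z, g z)"] assms
  show ?thesis by (auto intro: continuous_intros)
qed

lemma flow_iterate:
  assumes "\<phi> T y = y"
  shows "\<phi> (real n * T) y = y"
proof (induction n)
  case (Suc n)
  then show ?case using flow_add[of T "real n * T" y] assms by (simp add: algebra_simps)
qed auto

lemma flow_cancel:
  assumes "\<phi> s y = \<phi> t y"
  shows "\<phi> (t - s) y = y"
  using flow_add[of "-s" s y] flow_add[of "-s" t y] assms by simp

lemma orbit_flow: "y \<in> orbit \<phi> z \<longleftrightarrow> (\<exists>t. y = \<phi> t z)"
  by (auto simp: orbit_def)

lemma orbit_eq: "y \<in> orbit \<phi> z \<Longrightarrow> orbit \<phi> y = orbit \<phi> z"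
proof -
  assume "y \<in> orbit \<phi> z"
  then obtain t where t: "y = \<phi> t z" by (auto simp: orbit_flow)
  show ?thesis
  proof (intro set_eqI iffI)
    fix w assume "w \<in> orbit \<phi> y"
    then show "w \<in> orbit \<phi> z" using t by (auto simp: orbit_flow flow_add)
  next
    fix w assume "w \<in> orbit \<phi> z"
    then obtain s where "w = \<phi> s z" by (auto simp: orbit_flow)
    then have "w = \<phi> (s - t) y" using t by (simp add: flow_add)
    then show "w \<in> orbit \<phi> y" by (auto simp: orbit_flow)
  qed
qed

lemma flow_uniform:
  assumes "e > 0"
  obtains \<beta> where "\<beta> > 0" "\<And>y z t. dist y z < \<beta> \<Longrightarrow> \<bar>t\<bar> \<le> T \<Longrightarrow> dist (\<phi> t y) (\<phi> t z) < e"
proof -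
  have "uniformly_continuous_on ({-T..T} \<times> (UNIV::'a set)) (\<lambda>p. \<phi> (fst p) (snd p))"
    by (intro compact_uniformly_continuous compact_Times compact_UNIV continuous_intros) auto
  then obtain \<beta> where "\<beta> > 0" and \<beta>: "\<And>p q. p \<in> {-T..T} \<times> (UNIV::'a set) \<Longrightarrow> q \<in> {-T..T} \<times> UNIV \<Longrightarrow>
      dist q p < \<beta> \<Longrightarrow> dist (\<phi> (fst q) (snd q)) (\<phi> (fst p) (snd p)) < e"
    using assms unfolding uniformly_continuous_on_def by metis
  have "dist (\<phi> t y) (\<phi> t z) < e" if "dist y z < \<beta>" "\<bar>t\<bar> \<le> T" for y z t
    using \<beta>[of "(t, z)" "(t, y)"] that by (auto simp: dist_Pair_Pair abs_le_iff)
  with \<open>\<beta> > 0\<close> that show ?thesis by blast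
qed

lemma follows_translate:
  assumes "follows \<phi> e xs ts k y"
  shows "follows \<phi> e (\<lambda>i. xs (i + n)) (\<lambda>i. ts (i + n)) (\<lambda>t. k (t + u) - ssum ts n) (\<phi> u y)"
  unfolding follows_def
proof (intro allI impI, elim conjE)
  fix i t
  assume "ssum (\<lambda>i. ts (i + n)) i < k (t + u) - ssum ts n"
    "k (t + u) - ssum ts n < ssum (\<lambda>i. ts (i + n)) (i + 1)"
  moreover have "i + 1 + n = i + n + 1" by simp
  ultimately have "ssum ts (i + n) < k (t + u)" "k (t + u) < ssum ts (i + n + 1)"
    by (simp_all add: ssum_shift)
  then have "dist (\<phi> (t + u) y) (\<phi> (k (t + u) - ssum ts (i + n)) (xs (i + n))) \<le> e"
    using assms by (auto simp: follows_def)
  then show "dist (\<phi> t (\<phi> u y))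
      (\<phi> (k (t + u) - ssum ts n - ssum (\<lambda>i. ts (i + n)) i) (xs (i + n))) \<le> e"
    by (simp add: ssum_shift flow_add add.commute)
qed

lemma follows_closed_interval:
  assumes "follows \<phi> e xs ts k y" "time_change c k" "c > 0" "ssum ts i < ssum ts (i + 1)"
    "ssum ts i \<le> k t" "k t \<le> ssum ts (i + 1)"
  shows "dist (\<phi> t y) (\<phi> (k t - ssum ts i) (xs i)) \<le> e"
proof -
  note inv = time_change_inv[OF assms(2,3)]
  define a b where "a = inv k (ssum ts i)" and "b = inv k (ssum ts (i + 1))"
  have ab: "k a = ssum ts i" "k b = ssum ts (i + 1)" using inv by (auto simp: a_def b_def)
  have "a < b" using ab assms(4) time_change_less_iff[OF assms(2,3), of a b] by simp
  have "t \<in> closure {a<..<b}"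
    using \<open>a < b\<close> ab assms(5,6) time_change_le_iff[OF assms(2,3), of a t] time_change_le_iff[OF assms(2,3), of t b]
    by simp
  then show ?thesis
  proof (rule continuous_le_on_closure[of _ "\<lambda>t. dist (\<phi> t y) (\<phi> (k t - ssum ts i) (xs i))", rotated])
    fix s assume "s \<in> {a<..<b}"
    then have "ssum ts i < k s" "k s < ssum ts (i + 1)"
      using ab time_change_less_iff[OF assms(2,3), of a s] time_change_less_iff[OF assms(2,3), of s b] by auto
    then show "dist (\<phi> s y) (\<phi> (k s - ssum ts i) (xs i)) \<le> e"
      using assms(1) by (auto simp: follows_def)
  qed (intro continuous_intros time_change_continuous[OF assms(2,3)])
qed

text \<open>The time change is kept as a coordinate: the triples of parameter, time change and
  follower form a closed subset of a compact product, and forgetting the time change is a continuous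
  projection.\<close>

lemma compact_followers:
  fixes ts :: "'b::topological_space \<Rightarrow> int \<Rightarrow> real"
  assumes "compact \<Omega>" "\<And>i. continuous_on UNIV (\<lambda>\<omega>. ts \<omega> i)" "c > 0"
  shows "compact {(\<omega>, y). \<omega> \<in> \<Omega> \<and> (\<exists>k. time_change c k \<and> k 0 = 0 \<and> follows \<phi> e xs (ts \<omega>) k y)}"
proof -
  define K where "K = \<Omega> \<times> {k. time_change c k \<and> k 0 \<in> {0..0}} \<times> (UNIV::'a set)"
  have s: "continuous_on UNIV (\<lambda>\<omega>. ssum (ts \<omega>) i)" for i
    unfolding ssum_def by (cases "i \<ge> 0") (auto intro!: continuous_intros assms)
  have s': "continuous_on UNIV (\<lambda>z::'b \<times> (real \<Rightarrow> real) \<times> 'a. ssum (ts (fst z)) i)" for i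
    by (rule continuous_on_compose2[OF s]) (auto intro!: continuous_intros)
  have ev: "continuous_on UNIV (\<lambda>z::'b \<times> (real \<Rightarrow> real) \<times> 'a. fst (snd z) t)" for t
  proof (rule continuous_on_compose2[of UNIV "\<lambda>k. k t"])
    show "continuous_on UNIV (\<lambda>z::'b \<times> (real \<Rightarrow> real) \<times> 'a. fst (snd z))"
      by (intro continuous_on_fst continuous_on_snd continuous_on_id)
  qed auto
  define F where "F = (\<Inter>i. \<Inter>t. {z. (ssum (ts (fst z)) i < fst (snd z) t \<and> fst (snd z) t < ssum (ts (fst z)) (i + 1))
      \<longrightarrow> dist (\<phi> t (snd (snd z))) (\<phi> (fst (snd z) t - ssum (ts (fst z)) i) (xs i)) \<le> e})"
  have d: "continuous_on UNIV (\<lambda>z::'b \<times> (real \<Rightarrow> real) \<times> 'a.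
      dist (\<phi> t (snd (snd z))) (\<phi> (fst (snd z) t - ssum (ts (fst z)) i) (xs i)))" for i t
    by (intro continuous_on_dist continuous_on_flow continuous_on_diff ev s'
        continuous_on_const continuous_on_snd continuous_on_id)
  have "closed F" unfolding F_def
    by (intro closed_INT ballI closed_imp_Collect open_Collect_conj open_Collect_less closed_Collect_le
         d s' ev continuous_on_const)
  moreover have "compact K" unfolding K_def
    by (intro compact_Times compact_time_change compact_UNIV assms)
  ultimately have "compact (K \<inter> F)" by (intro compact_Int_closed)
  then have "compact ((\<lambda>z. (fst z, snd (snd z))) ` (K \<inter> F))"
    by (intro compact_continuous_image continuous_intros)
  moreover have "(\<lambda>z. (fst z, snd (snd z))) ` (K \<inter> F) =
      {(\<omega>, y). \<omega> \<in> \<Omega> \<and> (\<exists>k. time_change c k \<and> k 0 = 0 \<and> follows \<phi> e xs (ts \<omega>) k y)}"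
  proof (intro set_eqI iffI)
    fix z assume "z \<in> {(\<omega>, y). \<omega> \<in> \<Omega> \<and> (\<exists>k. time_change c k \<and> k 0 = 0 \<and> follows \<phi> e xs (ts \<omega>) k y)}"
    then obtain \<omega> y k where "z = (\<omega>, y)" "\<omega> \<in> \<Omega>" "time_change c k" "k 0 = 0" "follows \<phi> e xs (ts \<omega>) k y"
      by blast
    then have "(\<omega>, k, y) \<in> K \<inter> F"
      by (auto simp: K_def F_def follows_def)
    then show "z \<in> (\<lambda>z. (fst z, snd (snd z))) ` (K \<inter> F)"
      using \<open>z = (\<omega>, y)\<close> by (metis (no_types, lifting) fst_conv image_eqI snd_conv)
  qed (auto simp: K_def F_def follows_def)
  ultimately show ?thesis by simp
qed

text \<open>By Baire, the arc of times in [-n, n] has interior in the orbit for some n; by compactness the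
  orbit returns to that interior at a time larger than n.\<close>
lemma compact_orbit_periodic:
  assumes "compact (orbit \<phi> p)"
  obtains T where "T > 0" "\<phi> T p = p"
proof -
  define R where "R = orbit \<phi> p"
  define X where "X = subtopology euclidean R"
  define J where "J = (\<lambda>n::nat. (\<lambda>t. \<phi> t p) ` {- real n..real n})"
  have "compact R" using assms by (simp add: R_def)
  have "R \<noteq> {}" by (auto simp: R_def orbit_def)
  have R_un: "R = \<Union> (range J)"
  proof (intro set_eqI iffI)
    fix y assume "y \<in> R"
    then obtain t where "y = \<phi> t p" by (auto simp: R_def orbit_def)
    moreover obtain n :: nat where "\<bar>t\<bar> \<le> real n" using real_arch_simple by blast
    ultimately have "y \<in> J n" by (auto simp: J_def abs_le_iff)
    then show "y \<in> \<Union> (range J)" by blast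
  qed (auto simp: J_def R_def orbit_def)
  have J_closed: "closedin X (J n)" for n
  proof -
    have "compact (J n)" unfolding J_def by (intro compact_continuous_image continuous_intros) auto
    moreover have "J n \<subseteq> R" using R_un by auto
    ultimately show ?thesis by (simp add: X_def compact_imp_closed closed_subset)
  qed
  have "\<exists>n. X interior_of (J n) \<noteq> {}"
  proof (rule ccontr)
    assume empty: "\<not> (\<exists>n. X interior_of (J n) \<noteq> {})"
    have "compact_space X"
      using \<open>compact R\<close> by (simp add: X_def compact_space_subtopology)
    then have X: "locally_compact_space X" "regular_space X"
      by (simp_all add: compact_imp_locally_compact_space X_def regular_space_subtopology
          regular_space_euclidean)
    have "X interior_of \<Union> (range J) = {}"
    proof (rule Baire_category_alt)
      show "closedin X T \<and> X interior_of T = {}" if "T \<in> range J" for T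
        using that J_closed empty by blast
    qed (use X in auto)
    moreover have "topspace X = \<Union> (range J)" using R_un by (simp add: X_def)
    ultimately show False using \<open>R \<noteq> {}\<close> R_un interior_of_topspace[of X] by auto
  qed
  then obtain n q where q: "q \<in> X interior_of (J n)" by auto
  then obtain V where "openin X V" "q \<in> V" "V \<subseteq> J n" by (auto simp: interior_of_def)
  moreover then obtain W where "open W" "V = R \<inter> W" by (auto simp: X_def openin_open)
  ultimately have W: "open W" "q \<in> W" "R \<inter> W \<subseteq> J n" "q \<in> R" by auto
  obtain s where s: "q = \<phi> s p" using W(4) by (auto simp: R_def orbit_def)
  \<comment> \<open>The integer times accumulate at some \<open>l\<close> of the orbit; moving by
    \<open>s - v\<close> carries \<open>l\<close> to \<open>q\<close>, so the orbit enters
    \<open>W\<close> at arbitrarily late times.\<close>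
  have "\<forall>m. \<phi> (real m) p \<in> R" by (auto simp: R_def orbit_def)
  then obtain l r where lr: "l \<in> R" "strict_mono r" "((\<lambda>m. \<phi> (real m) p) \<circ> r) \<longlonglongrightarrow> l"
    using \<open>compact R\<close> unfolding compact_eq_seq_compact_metric seq_compact_def by metis
  obtain v where v: "l = \<phi> v p" using lr(1) by (auto simp: R_def orbit_def)
  have "isCont (\<lambda>y. \<phi> (s - v) y) l"
    using continuous_on_flow[of UNIV "\<lambda>_. s - v" "\<lambda>y. y"]
    by (simp add: continuous_on_eq_continuous_at continuous_on_const continuous_on_id)
  from isCont_tendsto_compose[OF this lr(3)]
  have "(\<lambda>m. \<phi> (real (r m) + (s - v)) p) \<longlonglongrightarrow> q"
    using v s by (simp add: flow_add o_def)
  then have "\<forall>\<^sub>F m in sequentially. \<phi> (real (r m) + (s - v)) p \<in> W"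
    using W(1,2) by (rule topological_tendstoD)
  moreover have "\<forall>\<^sub>F m in sequentially. real m > real n + \<bar>s - v\<bar>"
    using filterlim_real_sequentially by (simp add: filterlim_at_top_dense)
  ultimately have "\<forall>\<^sub>F m in sequentially. \<phi> (real (r m) + (s - v)) p \<in> W \<and> real m > real n + \<bar>s - v\<bar>"
    by eventually_elim auto
  from eventually_happens'[OF sequentially_bot this]
  obtain m where m: "\<phi> (real (r m) + (s - v)) p \<in> W" "real m > real n + \<bar>s - v\<bar>"
    by blast
  have "real (r m) \<ge> real m" using seq_suble[OF lr(2), of m] by simp
  then have big: "real (r m) + (s - v) > real n" using m(2) by linarith
  have "\<phi> (real (r m) + (s - v)) p \<in> J n" using m(1) W(3) by (auto simp: R_def orbit_def)
  then obtain u where u: "u \<le> real n" "\<phi> (real (r m) + (s - v)) p = \<phi> u p" by (auto simp: J_def)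
  show ?thesis
  proof (rule that)
    show "\<phi> (real (r m) + (s - v) - u) p = p" by (rule flow_cancel) (rule u(2)[symmetric])
    show "real (r m) + (s - v) - u > 0" using big u(1) by linarith
  qed
qed

end

subsection \<open>Recognising a suspension flow\<close>

lemma shiftn_0 [simp]: "shiftn 0 z = z"
  by (simp add: shiftn_def)

lemma shiftn_add: "shiftn m (shiftn n z) = shiftn (m + n) z"
  by (simp add: shiftn_def add.assoc)

lemma shiftn_mem:
  assumes "shift ` \<Sigma> = \<Sigma>" "z \<in> \<Sigma>"
  shows "shiftn n z \<in> \<Sigma>"
proof (induction n rule: int_induct[where k = 0])
  case (step1 i)
  then have "shift (shiftn i z) \<in> \<Sigma>" using assms(1) by blast
  then show ?case by (simp add: shift_def shiftn_add add.commute)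
next
  case (step2 i)
  then obtain z' where "z' \<in> \<Sigma>" "shiftn i z = shift z'" using assms(1) by blast
  then have "shiftn (-1) (shiftn i z) = z'" by (simp add: shift_def shiftn_add)
  then show ?case using \<open>z' \<in> \<Sigma>\<close> by (simp add: shiftn_add)
qed (use assms in auto)

lemma roof_sum_ssum: "roof_sum r z = ssum (\<lambda>k. r (shiftn k z))"
  by (simp add: roof_sum_def ssum_def fun_eq_iff)

text \<open>\<open>topology\<close> can be evaluated only on a predicate known to satisfy
  \<open>istopology\<close>. This is where the equivalence relation enters: distinct classes are
  disjoint, so the union of \<open>U \<inter> V\<close> is the intersection of the two
  unions.\<close>

lemma openin_quotient_topology:
  assumes "equiv (topspace T) R"
  shows "openin (quotient_topology T R) U \<longleftrightarrow> U \<subseteq> topspace T // R \<and> openin T (\<Union>U)"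
proof -
  have "istopology (\<lambda>U. U \<subseteq> topspace T // R \<and> openin T (\<Union>U))"
    unfolding istopology_def
  proof (intro conjI allI impI; (elim conjE)?)
    fix U V assume UV: "U \<subseteq> topspace T // R" "V \<subseteq> topspace T // R"
      and op: "openin T (\<Union> U)" "openin T (\<Union> V)"
    show "U \<inter> V \<subseteq> topspace T // R" using UV by auto
    have "\<Union> (U \<inter> V) = \<Union> U \<inter> \<Union> V"
    proof (intro equalityI subsetI)
      fix p assume "p \<in> \<Union> U \<inter> \<Union> V"
      then obtain c d where "c \<in> U" "d \<in> V" "p \<in> c" "p \<in> d" by auto
      moreover then have "c = d" using UV quotient_disj[OF assms, of c d] by blast
      ultimately show "p \<in> \<Union> (U \<inter> V)" by blast
    qed auto
    then show "openin T (\<Union> (U \<inter> V))" using op by auto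
  next
    fix \<K> assume K: "\<forall>K\<in>\<K>. K \<subseteq> topspace T // R \<and> openin T (\<Union> K)"
    then show "\<Union> \<K> \<subseteq> topspace T // R" by blast
    have "\<Union> (\<Union> \<K>) = \<Union> (Union ` \<K>)" by blast
    then show "openin T (\<Union> (\<Union> \<K>))" using K by (metis (no_types, lifting) imageE openin_Union)
  qed
  then show ?thesis by (simp add: quotient_topology_def topology_inverse')
qed

lemma topspace_quotient_topology:
  assumes "equiv (topspace T) R"
  shows "topspace (quotient_topology T R) = topspace T // R"
proof -
  have "openin (quotient_topology T R) (topspace T // R)"
    using Union_quotient[OF assms] by (simp add: openin_quotient_topology[OF assms])
  then show ?thesis
    using openin_quotient_topology[OF assms] by (metis openin_subset openin_topspace subset_antisym)
qed

lemma continuous_map_quotient_projection: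
  assumes "equiv (topspace T) R"
  shows "continuous_map T (quotient_topology T R) (\<lambda>p. R `` {p})"
  unfolding continuous_map_def topspace_quotient_topology[OF assms]
proof (intro conjI allI impI)
  show "(\<lambda>p. R `` {p}) \<in> topspace T \<rightarrow> topspace T // R" by (auto intro: quotientI)
  fix U assume "openin (quotient_topology T R) U"
  then have U: "U \<subseteq> topspace T // R" "openin T (\<Union>U)"
    by (auto simp: openin_quotient_topology[OF assms])
  have "{p \<in> topspace T. R `` {p} \<in> U} = \<Union> U"
  proof (intro equalityI subsetI)
    fix p assume "p \<in> \<Union> U"
    then obtain c where c: "c \<in> U" "p \<in> c" by auto
    have p: "p \<in> topspace T" using c U Union_quotient[OF assms] by blast
    then have "p \<in> R `` {p}" using assms by (meson equiv_class_self)
    then have "R `` {p} = c"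
      using c U p quotient_disj[OF assms, of "R `` {p}" c] quotientI[OF p] by blast
    then show "p \<in> {p \<in> topspace T. R `` {p} \<in> U}" using p c by auto
  next
    fix p assume "p \<in> {p \<in> topspace T. R `` {p} \<in> U}"
    then show "p \<in> \<Union> U" using equiv_class_self[OF assms, of p] by blast
  qed
  then show "openin T {p \<in> topspace T. R `` {p} \<in> U}" using U by simp
qed

lemma continuous_map_from_quotient:
  assumes "equiv (topspace T) R" "continuous_map T Z g"
    "\<And>p. p \<in> topspace T \<Longrightarrow> H (R `` {p}) = g p"
  shows "continuous_map (quotient_topology T R) Z H"
  unfolding continuous_map_def topspace_quotient_topology[OF assms(1)]
proof (intro conjI allI impI)
  show "H \<in> topspace T // R \<rightarrow> topspace Z"
    using assms(2,3) by (auto elim!: quotientE simp: continuous_map_def)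
  fix V assume V: "openin Z V"
  have "\<Union> {c \<in> topspace T // R. H c \<in> V} = {p \<in> topspace T. g p \<in> V}"
  proof (intro equalityI subsetI)
    fix p assume "p \<in> \<Union> {c \<in> topspace T // R. H c \<in> V}"
    then obtain c where c: "c \<in> topspace T // R" "H c \<in> V" "p \<in> c" by auto
    have p: "p \<in> topspace T" using c Union_quotient[OF assms(1)] by blast
    have "R `` {p} = c"
      using c p quotient_disj[OF assms(1), of "R `` {p}" c] quotientI[OF p]
        equiv_class_self[OF assms(1) p] by blast
    then show "p \<in> {p \<in> topspace T. g p \<in> V}" using c p assms(3)[OF p] by auto
  next
    fix p assume p: "p \<in> {p \<in> topspace T. g p \<in> V}"
    then have "p \<in> R `` {p}" "R `` {p} \<in> topspace T // R" "H (R `` {p}) \<in> V"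
      using equiv_class_self[OF assms(1)] quotientI assms(3) by auto
    then show "p \<in> \<Union> {c \<in> topspace T // R. H c \<in> V}" by blast
  qed
  moreover have "openin T {p \<in> topspace T. g p \<in> V}"
    using assms(2) V by (simp add: continuous_map_def)
  ultimately show "openin (quotient_topology T R) {c \<in> topspace T // R. H c \<in> V}"
    by (auto simp: openin_quotient_topology[OF assms(1)])
qed

context compact_flow begin

text \<open>The map \<open>g\<close>, sending \<open>(z, s)\<close> to
  \<open>\<phi> s (q z)\<close>, is continuous on the compact region under the roof, and by
  \<open>return\<close> and \<open>inj\<close> its fibres are exactly the classes of
  \<open>susp_rel\<close>. It descends to a continuous bijection from a compact space onto a
  Hausdorff one. The assumption \<open>inj\<close> combines two facts: \<open>q\<close> is
  injective, and the flow does not come back to its image before time \<open>r z\<close>.\<close>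

lemma suspension_conjugacy:
  fixes \<Sigma> :: "(int \<Rightarrow> nat) set" and q :: "(int \<Rightarrow> nat) \<Rightarrow> 'a" and r :: "(int \<Rightarrow> nat) \<Rightarrow> real"
  assumes \<Sigma>: "compact \<Sigma>" "shift ` \<Sigma> = \<Sigma>"
    and cont: "continuous_on \<Sigma> q" "continuous_on \<Sigma> r"
    and pos: "\<And>z. z \<in> \<Sigma> \<Longrightarrow> r z > 0"
    and return: "\<And>z. z \<in> \<Sigma> \<Longrightarrow> q (shift z) = \<phi> (r z) (q z)"
    and inj: "\<And>z z' u. z \<in> \<Sigma> \<Longrightarrow> z' \<in> \<Sigma> \<Longrightarrow> 0 \<le> u \<Longrightarrow> u < r z \<Longrightarrow> \<phi> u (q z) = q z' \<Longrightarrow>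
        u = 0 \<and> z' = z"
  shows "\<exists>Y. closed Y \<and> (\<forall>t. \<phi> t ` Y = Y) \<and> conj_to_suspension \<phi> Y \<Sigma> r"
proof -
  define D where "D = susp_dom \<Sigma> r"
  define R where "R = susp_rel \<Sigma> r"
  define g where "g = (\<lambda>p. \<phi> (snd p) (q (fst p)))"
  define Y where "Y = g ` D"
  have D: "(z, s) \<in> D \<longleftrightarrow> z \<in> \<Sigma> \<and> 0 \<le> s \<and> s \<le> r z" for z s
    by (simp add: D_def susp_dom_def)
  have mem: "shiftn n z \<in> \<Sigma>" if "z \<in> \<Sigma>" for n z using shiftn_mem[OF \<Sigma>(2) that] .
  have rs_step: "roof_sum r z (n + 1) = roof_sum r z n + r (shiftn n z)" for z n
    by (simp add: roof_sum_ssum ssum_step)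
  have q_shiftn: "q (shiftn n z) = \<phi> (roof_sum r z n) (q z)" if z: "z \<in> \<Sigma>" for n z
  proof (induction n rule: int_induct[where k = 0])
    case (step1 i)
    have "q (shiftn (i + 1) z) = q (shift (shiftn i z))"
      by (simp add: shift_def shiftn_add add.commute)
    then show ?case using return[OF mem[OF z]] step1(2) by (simp add: rs_step flow_add)
  next
    case (step2 i)
    have "q (shiftn i z) = q (shift (shiftn (i - 1) z))" by (simp add: shift_def shiftn_add)
    then have "\<phi> (- r (shiftn (i - 1) z)) (q (shiftn i z)) = q (shiftn (i - 1) z)"
      using return[OF mem[OF z]] by (simp add: flow_add)
    then show ?case using step2(2) rs_step[of z "i - 1"] by (simp add: flow_add)
  qed (simp add: roof_sum_ssum)

  have gD: "g (z, s) = \<phi> s (q z)" for z s by (simp add: g_def)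
  have step_g: "g p = g p'" if "(p, p') \<in> (let P = {((z, r z), (shift z, 0)) | z. z \<in> \<Sigma>} in (P \<union> P\<inverse>)\<^sup>*)" for p p'
    using that unfolding Let_def
    by (induction rule: rtrancl_induct) (auto simp: gD return)
  have g_half: "p = p'" if "p = (z, s)" "p' = (z', s')" "p \<in> D" "p' \<in> D" "s < r z" "s' < r z'" "s' \<le> s" "g p = g p'"
    for p p' z s z' s'
  proof -
    have "\<phi> s (q z) = \<phi> s' (q z')" using that by (simp add: gD)
    then have "\<phi> (s - s') (q z) = q z'"
      using flow_add[of "-s'" s "q z"] flow_add[of "-s'" s' "q z'"] by simp
    then have "s - s' = 0 \<and> z' = z" using that by (intro inj) (auto simp: D)
    then show ?thesis using that by simp
  qed
  define P where "P = {((z, r z), (shift z, 0::real)) | z. z \<in> \<Sigma>}"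
  have R_alt: "R = {(p, p'). p \<in> D \<and> p' \<in> D \<and> (p, p') \<in> (P \<union> P\<inverse>)\<^sup>*}"
    by (auto simp: R_def susp_rel_def D_def P_def Let_def)
  have symP: "(p', p) \<in> (P \<union> P\<inverse>)\<^sup>*" if "(p, p') \<in> (P \<union> P\<inverse>)\<^sup>*" for p p'
  proof -
    have "sym (P \<union> P\<inverse>)" by (rule sym_Un_converse)
    then show ?thesis using that sym_rtrancl symD by metis
  qed
  \<comment> \<open>A point on the roof moves to the bottom of the next fibre, which is strictly
    below its own roof because \<open>r\<close> is positive. Strictly below the roof,
    \<open>g_half\<close> makes \<open>g\<close> injective.\<close>
  have lower: "\<exists>p'. (p, p') \<in> (P \<union> P\<inverse>)\<^sup>* \<and> p' \<in> D \<and> snd p' < r (fst p') \<and> g p' = g p" if "p \<in> D" for p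
  proof (cases "snd p < r (fst p)")
    case True
    then show ?thesis using that by blast
  next
    case False
    obtain z s where zs: "p = (z, s)" by (cases p)
    then have p: "p = (z, r z)" "z \<in> \<Sigma>" using that False D by auto
    then have z: "shift z \<in> \<Sigma>" using \<Sigma>(2) by blast
    have "(p, (shift z, 0)) \<in> (P \<union> P\<inverse>)\<^sup>*" using p by (auto simp: P_def)
    moreover have "(shift z, 0) \<in> D" using z pos[OF z] by (simp add: D)
    moreover have "g (shift z, 0) = g p" using p return by (simp add: gD)
    ultimately show ?thesis using pos[OF z] by force
  qed
  have R_iff: "R = {(p, p'). p \<in> D \<and> p' \<in> D \<and> g p = g p'}"
  proof (intro set_eqI iffI)
    fix x assume "x \<in> R"
    then show "x \<in> {(p, p'). p \<in> D \<and> p' \<in> D \<and> g p = g p'}"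
      using step_g by (auto simp: R_alt P_def Let_def)
  next
    fix x assume "x \<in> {(p, p'). p \<in> D \<and> p' \<in> D \<and> g p = g p'}"
    then obtain p p' where x: "x = (p, p')" "p \<in> D" "p' \<in> D" "g p = g p'" by auto
    obtain a where a: "(p, a) \<in> (P \<union> P\<inverse>)\<^sup>*" "a \<in> D" "snd a < r (fst a)" "g a = g p"
      using lower[OF x(2)] by blast
    obtain b where b: "(p', b) \<in> (P \<union> P\<inverse>)\<^sup>*" "b \<in> D" "snd b < r (fst b)" "g b = g p'"
      using lower[OF x(3)] by blast
    have "a = b"
      using g_half[of a "fst a" "snd a" b "fst b" "snd b"] g_half[of b "fst b" "snd b" a "fst a" "snd a"]
        a b x(4) by (cases "snd b \<le> snd a") auto
    then have "(p, p') \<in> (P \<union> P\<inverse>)\<^sup>*" using a(1) symP[OF b(1)] by (auto intro: rtrancl_trans)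
    then show "x \<in> R" using x by (auto simp: R_alt)
  qed
  define T where "T = subtopology euclidean D"
  have topT: "topspace T = D" by (simp add: T_def)
  have eq: "equiv (topspace T) R" unfolding topT
    by (rule equivI) (auto simp: R_iff refl_on_def sym_on_def trans_on_def)
  have space: "susp_space \<Sigma> r = quotient_topology T R"
    by (simp add: susp_space_def T_def R_def D_def)
  have top: "topspace (susp_space \<Sigma> r) = D // R"
    by (simp add: space topspace_quotient_topology[OF eq] topT)
  have Rg: "g p = g p'" if "(p, p') \<in> R" for p p' using that by (simp add: R_iff)
  define H where "H = (\<lambda>c. g (SOME p. p \<in> c))"
  have HR: "H (R `` {p}) = g p" if "p \<in> D" for p
  proof -
    have "p \<in> R `` {p}" using that by (simp add: R_iff)
    then have "(SOME p'. p' \<in> R `` {p}) \<in> R `` {p}" by (rule someI)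
    then have "(p, SOME p'. p' \<in> R `` {p}) \<in> R" by simp
    then have "g p = g (SOME p'. p' \<in> R `` {p})" using Rg by blast
    then show ?thesis by (simp add: H_def)
  qed
  have g_cont: "continuous_on D g"
    unfolding g_def
  proof (rule continuous_on_flow)
    show "continuous_on D (\<lambda>p. q (fst p))"
      by (rule continuous_on_compose2[OF cont(1)]) (auto simp: D intro: continuous_on_fst continuous_on_id)
  qed (intro continuous_on_snd continuous_on_id)
  \<comment> \<open>Rescaling the fibres exhibits \<open>D\<close> as a continuous image of
    \<open>\<Sigma> \<times> {0..1}\<close>.\<close>
  have "continuous_on (\<Sigma> \<times> {0..1::real}) (\<lambda>p. r (fst p))"
    by (rule continuous_on_compose2[OF cont(2)]) (auto intro: continuous_on_fst continuous_on_id)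
  then have "compact ((\<lambda>p. (fst p, snd p * r (fst p))) ` (\<Sigma> \<times> {0..1::real}))"
    by (intro compact_continuous_image compact_Times \<Sigma>(1) compact_Icc continuous_on_Pair
        continuous_on_mult continuous_on_fst continuous_on_snd continuous_on_id)
  moreover have "(\<lambda>p. (fst p, snd p * r (fst p))) ` (\<Sigma> \<times> {0..1::real}) = D"
  proof (intro equalityI subsetI)
    fix p assume "p \<in> D"
    then obtain z s where p: "p = (z, s)" "z \<in> \<Sigma>" "0 \<le> s" "s \<le> r z" by (cases p) (auto simp: D)
    then have "(z, s / r z) \<in> \<Sigma> \<times> {0..1}" using pos[of z] by (auto simp: field_simps)
    moreover have "p = (\<lambda>p. (fst p, snd p * r (fst p))) (z, s / r z)" using p pos[of z] by auto
    ultimately show "p \<in> (\<lambda>p. (fst p, snd p * r (fst p))) ` (\<Sigma> \<times> {0..1})" by blast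
  qed (use pos in \<open>auto simp: D mult_left_le_one_le less_imp_le\<close>)
  ultimately have D_compact: "compact D" by simp
  then have "compact Y" unfolding Y_def by (intro compact_continuous_image g_cont)
  then have Y_closed: "closed Y" by (rule compact_imp_closed)

  \<comment> \<open>A positive lower bound of the roof makes the roof sums unbounded in both
    directions, so every time falls into some fibre.\<close>
  obtain \<rho> where \<rho>: "\<rho> > 0" "\<And>z. z \<in> \<Sigma> \<Longrightarrow> \<rho> \<le> r z"
  proof (cases "\<Sigma> = {}")
    case False
    then obtain z0 where "z0 \<in> \<Sigma>" "\<forall>z\<in>\<Sigma>. r z0 \<le> r z"
      using continuous_attains_inf[OF \<Sigma>(1) _ cont(2)] by blast
    then show ?thesis using that pos by blast
  qed (use that[of 1] in auto)
  have locate: "\<exists>n. roof_sum r z n \<le> v \<and> v < roof_sum r z (n + 1)" if "z \<in> \<Sigma>" for z v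
    using ssum_locate[of \<rho> "\<lambda>k. r (shiftn k z)" v] \<rho> mem[OF that] by (metis roof_sum_ssum)
  have point: "(shiftn n z, v - roof_sum r z n) \<in> D \<and> g (shiftn n z, v - roof_sum r z n) = \<phi> v (q z)"
    if "z \<in> \<Sigma>" "roof_sum r z n \<le> v" "v < roof_sum r z (n + 1)" for z n v
    using that mem[OF that(1), of n] q_shiftn[OF that(1), of n] rs_step[of z n]
    by (auto simp: D gD flow_add)
  have inv_sub: "\<phi> t ` Y \<subseteq> Y" for t
  proof
    fix y assume "y \<in> \<phi> t ` Y"
    then obtain z s where y: "y = \<phi> t (g (z, s))" "(z, s) \<in> D" by (auto simp: Y_def)
    then have z: "z \<in> \<Sigma>" by (simp add: D)
    obtain n where "roof_sum r z n \<le> s + t" "s + t < roof_sum r z (n + 1)" using locate[OF z] by blast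
    from point[OF z this] show "y \<in> Y" using y by (force simp: Y_def gD flow_add)
  qed
  have inv: "\<phi> t ` Y = Y" for t
  proof
    show "Y \<subseteq> \<phi> t ` Y"
    proof
      fix y assume "y \<in> Y"
      then have "\<phi> (-t) y \<in> Y" using inv_sub by blast
      then show "y \<in> \<phi> t ` Y" by (rule rev_image_eqI) (simp add: flow_add)
    qed
  qed (rule inv_sub)

  have "homeomorphic_map (susp_space \<Sigma> r) (subtopology euclidean Y) H"
  proof (rule continuous_imp_homeomorphic_map)
    show "continuous_map (susp_space \<Sigma> r) (top_of_set Y) H"
      unfolding space
    proof (rule continuous_map_from_quotient[OF eq])
      show "continuous_map T (top_of_set Y) g"
        using g_cont by (auto simp: T_def Y_def)
    qed (use HR topT in auto)
    have "compactin T D" using D_compact by (simp add: T_def compactin_subtopology)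
    from image_compactin[OF this continuous_map_quotient_projection[OF eq]]
    have "compactin (susp_space \<Sigma> r) ((\<lambda>p. R `` {p}) ` D)" by (simp add: space)
    moreover have proj: "(\<lambda>p. R `` {p}) ` D = D // R" by (auto simp: quotient_def)
    ultimately show "compact_space (susp_space \<Sigma> r)" by (simp add: compact_space_def top)
    show "Hausdorff_space (top_of_set Y)" by (simp add: Hausdorff_space_subtopology)
    show "H ` topspace (susp_space \<Sigma> r) = topspace (top_of_set Y)"
      using HR by (simp add: top Y_def image_image flip: proj)
    show "inj_on H (topspace (susp_space \<Sigma> r))"
      unfolding top
    proof (rule inj_onI)
      fix c d assume "c \<in> D // R" "d \<in> D // R" "H c = H d"
      then obtain p p' where p: "c = R `` {p}" "p \<in> D" "d = R `` {p'}" "p' \<in> D"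
        by (auto elim!: quotientE)
      then have "(p, p') \<in> R" using \<open>H c = H d\<close> HR by (simp add: R_iff)
      then show "c = d" using p equiv_class_eq[OF eq] by blast
    qed
  qed
  moreover have "H (susp_flow \<Sigma> r t c) = \<phi> t (H c)" if "c \<in> topspace (susp_space \<Sigma> r)" for t c
  proof -
    have "c \<in> D // R" using that top by simp
    then obtain p0 where p0: "c = R `` {p0}" "p0 \<in> D" by (rule quotientE)
    have Hc: "H c = g p0" using p0 HR by simp
    \<comment> \<open>\<open>susp_flow\<close> is a union over all representatives of
      \<open>c\<close>; by \<open>cls\<close> every member of this union is the same class
      \<open>E\<close>.\<close>
    define E where "E = {p' \<in> D. g p' = \<phi> t (H c)}"
    have cls: "R `` {(shiftn n z, s + t - roof_sum r z n)} = E \<and> (shiftn n z, s + t - roof_sum r z n) \<in> E"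
      if "(z, s) \<in> c" "roof_sum r z n \<le> s + t" "s + t < roof_sum r z (n + 1)" for z s n
    proof -
      have zs: "(z, s) \<in> D" "g (z, s) = H c" using that p0 Hc by (auto simp: R_iff)
      then have "z \<in> \<Sigma>" by (simp add: D)
      from point[OF this that(2,3)]
      have "(shiftn n z, s + t - roof_sum r z n) \<in> D"
        "g (shiftn n z, s + t - roof_sum r z n) = \<phi> t (H c)"
        using zs by (auto simp: gD flow_add[of t s, symmetric])
      then show ?thesis by (auto simp: R_iff E_def)
    qed
    obtain z0 s0 where zs0: "p0 = (z0, s0)" by (cases p0)
    then have "(z0, s0) \<in> c" "z0 \<in> \<Sigma>" using p0 by (auto simp: R_iff D)
    obtain n where n: "roof_sum r z0 n \<le> s0 + t" "s0 + t < roof_sum r z0 (n + 1)"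
      using locate[OF \<open>z0 \<in> \<Sigma>\<close>] by blast
    define p1 where "p1 = (shiftn n z0, s0 + t - roof_sum r z0 n)"
    have p1: "R `` {p1} = E" "p1 \<in> E" using cls[OF \<open>(z0, s0) \<in> c\<close> n] by (simp_all add: p1_def)
    have "susp_flow \<Sigma> r t c = E"
      unfolding susp_flow_def R_def[symmetric]
    proof (intro equalityI subsetI)
      fix p assume "p \<in> E"
      moreover have "E \<in> {R `` {(shiftn n z, s + t - roof_sum r z n)} | z s n.
          (z, s) \<in> c \<and> roof_sum r z n \<le> s + t \<and> s + t < roof_sum r z (n + 1)}"
        using p1(1)[symmetric] \<open>(z0, s0) \<in> c\<close> n unfolding p1_def by blast
      ultimately show "p \<in> \<Union> {R `` {(shiftn n z, s + t - roof_sum r z n)} | z s n.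
          (z, s) \<in> c \<and> roof_sum r z n \<le> s + t \<and> s + t < roof_sum r z (n + 1)}" by blast
    next
      fix p assume "p \<in> \<Union> {R `` {(shiftn n z, s + t - roof_sum r z n)} | z s n.
          (z, s) \<in> c \<and> roof_sum r z n \<le> s + t \<and> s + t < roof_sum r z (n + 1)}"
      then obtain z s n where "p \<in> R `` {(shiftn n z, s + t - roof_sum r z n)}" "(z, s) \<in> c"
        "roof_sum r z n \<le> s + t" "s + t < roof_sum r z (n + 1)" by blast
      then show "p \<in> E" using cls by simp
    qed
    then have "H (susp_flow \<Sigma> r t c) = g p1" using p1(1) HR[of p1] p1(2) by (simp add: E_def)
    then show ?thesis using p1 by (simp add: E_def)
  qed
  ultimately have "conj_to_suspension \<phi> Y \<Sigma> r"
    unfolding conj_to_suspension_def by blast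
  then show ?thesis using Y_closed inv by blast
qed

end

subsection \<open>Recurring segments as markers\<close>

text \<open>A block consists of a marker, the segment of length \<open>b\<close> of the orbit of
  \<open>x\<close>, and a filler of length \<open>N j\<close> along \<open>p\<close>. In
  \<open>unfollowed\<close>, 25/16 is the square of 5/4, the distortion between two clocks, and
  \<open>3 * e\<close> allows for an orbit within \<open>2 * e\<close> of the marker and within
  \<open>e\<close> of the filler. Fillers of length \<open>100 * b\<close> make recognition errors
  of a few \<open>b\<close> negligible, so that doubled lengths remain distinguishable after
  distortion. \<open>Nmax\<close> will bound the return time.\<close>

locale horseshoe = compact_flow \<phi> for \<phi> :: "real \<Rightarrow> 'a::metric_space \<Rightarrow> 'a" +
  fixes x p :: 'a and e b Nmax :: real and N :: "nat \<Rightarrow> real" and \<Sigma> :: "(int \<Rightarrow> nat) set"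
  assumes e_pos: "e > 0" and b_ge: "b \<ge> 1"
    and N_ge: "N j \<ge> 100 * b"
    and N_double: "i < j \<Longrightarrow> 2 * N i \<le> N j"
    and \<Sigma>_compact: "compact \<Sigma>" and \<Sigma>_shift: "shift ` \<Sigma> = \<Sigma>"
    and aperiodic: "z \<in> \<Sigma> \<Longrightarrow> shiftn n z = z \<Longrightarrow> n = 0"
    and N_le: "z \<in> \<Sigma> \<Longrightarrow> N (z i) \<le> Nmax"
    and shadowed: "z \<in> \<Sigma> \<Longrightarrow> \<exists>y k. time_change (5/4) k \<and> k 0 = 0 \<and>
        follows \<phi> e (\<lambda>i. if even i then x else p) (\<lambda>i. if even i then b else N (z (i div 2))) k y"
    and same_orbit: "time_change (5/4) k \<Longrightarrow> k 0 = 0 \<Longrightarrow> time_change (5/4) k' \<Longrightarrow> k' 0 = 0 \<Longrightarrow>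
        follows \<phi> e (\<lambda>i. if even i then x else p) (\<lambda>i. if even i then b else N (z (i div 2))) k y \<Longrightarrow>
        follows \<phi> e (\<lambda>i. if even i then x else p) (\<lambda>i. if even i then b else N (z (i div 2))) k' y' \<Longrightarrow>
        y' \<in> orbit \<phi> y"
    and unfollowed: "time_change (25/16) \<kappa> \<Longrightarrow> \<exists>t. 0 < t \<and> t < b \<and> dist (\<phi> t x) (\<phi> (\<kappa> t) p) > 3 * e"
begin

definition base :: "int \<Rightarrow> 'a" where "base i = (if even i then x else p)"
definition dur :: "(int \<Rightarrow> nat) \<Rightarrow> int \<Rightarrow> real" where "dur z i = (if even i then b else N (z (i div 2)))"
definition start :: "(int \<Rightarrow> nat) \<Rightarrow> int \<Rightarrow> real" where "start z i = ssum (dur z) (2 * i)"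
text \<open>No value of \<open>k\<close> at 0 is prescribed, so tracking survives moving along the
  orbit; \<open>S\<close> singles out the points placed at the beginning of block 0.\<close>

definition track :: "(int \<Rightarrow> nat) \<Rightarrow> (real \<Rightarrow> real) \<Rightarrow> 'a \<Rightarrow> bool" where
  "track z k y \<longleftrightarrow> z \<in> \<Sigma> \<and> time_change (5/4) k \<and> follows \<phi> e base (dur z) k y"
definition S :: "((int \<Rightarrow> nat) \<times> 'a) set" where
  "S = {(z, y). z \<in> \<Sigma> \<and> (\<exists>k. time_change (5/4) k \<and> k 0 = 0 \<and> follows \<phi> e base (dur z) k y)}"

lemma S_track: "(z, y) \<in> S \<longleftrightarrow> (\<exists>k. track z k y \<and> k 0 = 0)"
  by (auto simp: S_def track_def)

lemma dur_ge: "dur z i \<ge> 1"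
  using b_ge N_ge[of "z (i div 2)"] by (auto simp: dur_def)

lemma start_0 [simp]: "start z 0 = 0"
  by (simp add: start_def)

lemma ssum_odd: "ssum (dur z) (2 * i + 1) = start z i + b"
  by (simp add: ssum_step start_def dur_def)

lemma start_Suc: "start z (i + 1) = start z i + b + N (z i)"
proof -
  have "start z (i + 1) = ssum (dur z) (2 * i + 1 + 1)" by (simp add: start_def algebra_simps)
  also have "\<dots> = start z i + b + dur z (2 * i + 1)" by (simp only: ssum_step[of _ "2 * i + 1"] ssum_odd)
  finally show ?thesis by (simp add: dur_def)
qed

lemma dur_shiftn: "dur (shiftn n z) = (\<lambda>i. dur z (i + 2 * n))"
proof
  fix i :: int
  have "(i + 2 * n) div 2 = i div 2 + n" by simp
  then show "dur (shiftn n z) i = dur z (i + 2 * n)" by (simp add: dur_def shiftn_def add.commute)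
qed

lemma start_gap:
  assumes "i \<le> j"
  shows "101 * b * (j - i) \<le> start z j - start z i"
  using assms
proof (induction j rule: int_ge_induct)
  case (step j)
  then show ?case using start_Suc[of z j] N_ge[of "z j"] by (simp add: algebra_simps)
qed auto

lemma start_gap1:
  assumes "i < j"
  shows "start z i + 101 * b \<le> start z j"
proof -
  have "101 * b * 1 \<le> 101 * b * (real_of_int j - real_of_int i)"
    using assms b_ge by (intro mult_left_mono) auto
  then show ?thesis using start_gap[of i j z] assms by simp
qed

lemma start_less: "start z i < start z j \<Longrightarrow> i < j"
  using start_gap1[of j i z] b_ge by (cases i j rule: linorder_cases) auto

lemma track_shiftn:
  assumes "track z k y"
  shows "track (shiftn n z) (\<lambda>t. k (t + u) - start z n) (\<phi> u y)"
proof -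
  have "(\<lambda>i. base (i + 2 * n)) = base" by (simp add: base_def fun_eq_iff)
  then show ?thesis
    using assms follows_translate[of e base "dur z" k y "2 * n" u] shiftn_mem[OF \<Sigma>_shift]
    by (simp add: track_def time_change_translate dur_shiftn start_def)
qed

lemma track_even:
  assumes "track z k y" "start z i < k t" "k t < start z i + b"
  shows "dist (\<phi> t y) (\<phi> (k t - start z i) x) \<le> e"
proof -
  have "ssum (dur z) (2 * i) < k t \<and> k t < ssum (dur z) (2 * i + 1)"
    using assms ssum_odd by (simp add: start_def)
  then have "dist (\<phi> t y) (\<phi> (k t - ssum (dur z) (2 * i)) (base (2 * i))) \<le> e"
    using assms(1) unfolding track_def follows_def by blast
  then show ?thesis by (simp add: base_def start_def)
qed

lemma track_odd:
  assumes "track z k y" "start z i + b < k t" "k t < start z (i + 1)"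
  shows "dist (\<phi> t y) (\<phi> (k t - (start z i + b)) p) \<le> e"
proof -
  have "ssum (dur z) (2 * i + 1) < k t \<and> k t < ssum (dur z) (2 * i + 1 + 1)"
    using assms ssum_odd[of z i] by (simp add: start_def algebra_simps)
  then have "dist (\<phi> t y) (\<phi> (k t - ssum (dur z) (2 * i + 1)) (base (2 * i + 1))) \<le> e"
    using assms(1) unfolding track_def follows_def by blast
  then show ?thesis by (simp add: base_def ssum_odd)
qed

lemma track_time_change: "track z k y \<Longrightarrow> time_change (5/4) k"
  by (simp add: track_def)

section \<open>Reading the sequence off an orbit\<close>

lemma time_change_abs:
  assumes "time_change (5/4) k"
  shows "\<bar>t - s\<bar> \<le> 5/4 * \<bar>k t - k s\<bar>" "\<bar>k t - k s\<bar> \<le> 5/4 * \<bar>t - s\<bar>"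
  using time_changeD[OF assms, of s t] time_changeD[OF assms, of t s] by (cases "s \<le> t"; auto)+

lemma compose_inv:
  assumes "time_change (5/4) k" "time_change (5/4) k'"
  shows "time_change (25/16) (\<lambda>v. k (inv k' v + t0) - c)"
  using time_change_translate[OF time_change_compose[OF assms(1) time_change_translate[OF time_change_inv(1)[OF assms(2)], of 0 "-t0"]], of 0 c]
  by simp

text \<open>Along a \<^term>\<open>p\<close>-segment the orbit cannot follow the loop of \<^term>\<open>x\<close>, so such a loop can only be
  followed near the beginning of a block.\<close>
lemma recognize:
  assumes "track z k y" "time_change (5/4) k'" "k' 0 = 0"
    and near: "\<And>t. 0 < k' t \<Longrightarrow> k' t < b \<Longrightarrow> dist (\<phi> (t0 + t) y) (\<phi> (k' t) x) \<le> 2 * e"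
  shows "\<exists>j. \<bar>k t0 - start z j\<bar> \<le> 2 * b"
proof (rule ccontr)
  assume far: "\<not> ?thesis"
  note k = track_time_change[OF assms(1)]
  note inv' = time_change_inv[OF assms(2), simplified]
  obtain i where i: "ssum (dur z) i \<le> k t0" "k t0 < ssum (dur z) (i + 1)"
    using ssum_locate[of 1 "dur z" "k t0"] dur_ge by auto
  have "odd i"
  proof
    assume "even i"
    then obtain j where "i = 2 * j" by auto
    then have "\<bar>k t0 - start z j\<bar> \<le> 2 * b" using i ssum_odd[of z j] b_ge by (auto simp: start_def)
    then show False using far by blast
  qed
  then obtain j where ij: "i = 2 * j + 1" by (auto elim: oddE)
  have "i + 1 = 2 * (j + 1)" using ij by simp
  then have up: "k t0 < start z (j + 1)" using i(2) by (simp only: start_def)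
  have lo: "start z j + b \<le> k t0" using i ij ssum_odd by simp
  have lo2: "start z j + 2 * b < k t0"
    using far lo b_ge by (smt (verit))
  have up2: "k t0 < start z (j + 1) - 2 * b"
    using far up b_ge by (smt (verit))
  define \<kappa> where "\<kappa> = (\<lambda>v. k (inv k' v + t0) - (start z j + b))"
  have "time_change (25/16) \<kappa>" unfolding \<kappa>_def by (rule compose_inv[OF k assms(2)])
  from unfollowed[OF this] obtain v where v: "0 < v" "v < b" "dist (\<phi> v x) (\<phi> (\<kappa> v) p) > 3 * e"
    by blast
  define t where "t = inv k' v"
  have kt: "k' t = v" using inv' by (simp add: t_def)
  have t: "0 < t" using kt v assms(3) time_change_less_iff[OF assms(2), of 0 t] by simp
  have "t \<le> 5/4 * v" using time_change_abs(1)[OF assms(2), of t 0] kt v t assms(3) by simp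
  \<comment> \<open>While the marker is followed for time less than \<open>b\<close>, the clock
    \<open>k\<close> advances by less than \<open>25/16 * b\<close>, which is below
    \<open>2 * b\<close>; so it does not leave the filler.\<close>
  then have "k (t0 + t) - k t0 \<le> 5/4 * (5/4 * v)" "k t0 < k (t0 + t)"
    using time_changeD(2)[OF k, of t0 "t0 + t"] time_change_less[OF k, of t0 "t0 + t"] t by auto
  then have "start z j + b < k (t0 + t)" "k (t0 + t) < start z (j + 1)"
    using lo2 up2 v b_ge by auto
  from track_odd[OF assms(1) this]
  have "dist (\<phi> (t0 + t) y) (\<phi> (\<kappa> v) p) \<le> e" by (simp add: \<kappa>_def t_def add.commute)
  moreover have "dist (\<phi> (t0 + t) y) (\<phi> v x) \<le> 2 * e" using near[of t] kt v by simp
  ultimately have "dist (\<phi> v x) (\<phi> (\<kappa> v) p) \<le> 3 * e"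
    using dist_triangle3[of "\<phi> v x" "\<phi> (\<kappa> v) p" "\<phi> (t0 + t) y"] by linarith
  then show False using v by simp
qed

lemma recognize_track:
  assumes "track z k y" "track z' k' y"
  shows "\<exists>j. \<bar>k (inv k' (start z' i)) - start z j\<bar> \<le> 2 * b"
proof -
  define t0 where "t0 = inv k' (start z' i)"
  have t0: "k' t0 = start z' i" using time_change_inv[OF track_time_change[OF assms(2)]] by (simp add: t0_def)
  show ?thesis unfolding t0_def[symmetric]
  proof (rule recognize[OF assms(1)])
    show "time_change (5/4) (\<lambda>t. k' (t + t0) - start z' i)" using track_time_change[OF assms(2)] by (rule time_change_translate)
    show "k' (0 + t0) - start z' i = 0" using t0 by simp
    fix t assume "0 < k' (t + t0) - start z' i" "k' (t + t0) - start z' i < b"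
    then show "dist (\<phi> (t0 + t) y) (\<phi> (k' (t + t0) - start z' i) x) \<le> 2 * e"
      using track_even[OF assms(2), of i "t + t0"] e_pos by (simp add: add.commute)
  qed
qed

text \<open>The map \<open>\<kappa>\<close> converts the clock of \<open>z'\<close> into that of
  \<open>z\<close> and takes two consecutive block starts of \<open>z'\<close> to within
  \<open>2 * b\<close> of block starts of \<open>z\<close>. If a further start of \<open>z\<close>
  lay in between, recognition with the roles exchanged would produce a start of \<open>z'\<close>
  between two consecutive ones. Hence the two blocks correspond, and their lengths agree up to the
  factor 25/16 and an error of \<open>4 * b\<close>, too little for one filler to be twice as long
  as the other.\<close>

lemma code_step:
  assumes "track z k y" "track z' k' y"
    and J: "\<bar>k (inv k' (start z' i)) - start z j\<bar> \<le> 2 * b"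
      "\<bar>k (inv k' (start z' (i + 1))) - start z j'\<bar> \<le> 2 * b"
  shows "j' = j + 1 \<and> z' i = z j"
proof -
  note k = track_time_change[OF assms(1)] and k' = track_time_change[OF assms(2)]
  note inv = time_change_inv[OF k, simplified] and inv' = time_change_inv[OF k', simplified]
  define \<kappa> where "\<kappa> = (\<lambda>v. k (inv k' v))"
  have \<kappa>: "time_change (25/16) \<kappa>" using compose_inv[OF k k', of 0 0] by (simp add: \<kappa>_def)
  have J': "\<bar>\<kappa> (start z' i) - start z j\<bar> \<le> 2 * b" "\<bar>\<kappa> (start z' (i + 1)) - start z j'\<bar> \<le> 2 * b"
    using J by (auto simp: \<kappa>_def)
  define s where "s = start z' i"
  define s1 where "s1 = start z' (i + 1)"
  have s1: "s1 = s + b + N (z' i)" by (simp add: s_def s1_def start_Suc)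
  have N': "N (z' i) \<ge> 100 * b" by (rule N_ge)
  have ss: "s \<le> s1" using s1 N' b_ge by simp
  have D: "(16/25) * (s1 - s) \<le> \<kappa> s1 - \<kappa> s" "\<kappa> s1 - \<kappa> s \<le> 25/16 * (s1 - s)"
    using time_changeD[OF \<kappa> ss] by auto
  have J'': "\<bar>\<kappa> s - start z j\<bar> \<le> 2 * b" "\<bar>\<kappa> s1 - start z j'\<bar> \<le> 2 * b"
    using J' by (auto simp: s_def s1_def)
  have J3: "\<kappa> s \<le> start z j + 2 * b" "start z j \<le> \<kappa> s + 2 * b"
    "\<kappa> s1 \<le> start z j' + 2 * b" "start z j' \<le> \<kappa> s1 + 2 * b"
    using J'' by (auto simp: abs_le_iff)
  have "start z j < start z j'" using D(1) J3 s1 N' b_ge by argo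
  then have "j < j'" by (rule start_less)
  have "j' = j + 1"
  proof (rule ccontr)
    assume "j' \<noteq> j + 1"
    with \<open>j < j'\<close> have "j + 1 < j'" by simp
    define v where "v = start z (j + 1)"
    have v: "v \<ge> start z j + 101 * b" "v \<le> start z j' - 101 * b"
      using start_gap1[of j "j + 1" z] start_gap1[OF \<open>j + 1 < j'\<close>, of z] by (auto simp: v_def)
    obtain i' where i': "\<bar>k' (inv k v) - start z' i'\<bar> \<le> 2 * b"
      using recognize_track[OF assms(2,1), of "j + 1"] by (auto simp: v_def)
    define w where "w = k' (inv k v)"
    have \<kappa>w: "\<kappa> w = v" using inv inv' by (simp add: \<kappa>_def w_def)
    have "\<kappa> s < \<kappa> w" "\<kappa> w < \<kappa> s1" using \<kappa>w v J3 b_ge by linarith+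
    then have "s < w" "w < s1" using time_change_less_iff[OF \<kappa>] by auto
    then have "\<kappa> w - \<kappa> s \<le> 25/16 * (w - s)" "\<kappa> s1 - \<kappa> w \<le> 25/16 * (s1 - w)"
      using time_changeD(2)[OF \<kappa>, of s w] time_changeD(2)[OF \<kappa>, of w s1] by auto
    \<comment> \<open>On the clock of \<open>z\<close> the gaps are at least \<open>99 * b\<close>;
      on that of \<open>z'\<close> at least 16/25 of this is left, still far more than
      \<open>2 * b\<close>.\<close>
    then have "s + 2 * b < w" "w + 2 * b < s1" using \<kappa>w v J3 b_ge by argo+
    moreover have "w \<le> start z' i' + 2 * b" "start z' i' \<le> w + 2 * b"
      using i' by (auto simp: w_def abs_le_iff)
    ultimately have "start z' i < start z' i'" "start z' i' < start z' (i + 1)"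
      by (auto simp: s_def s1_def)
    then show False using start_less[of z' i i'] start_less[of z' i' "i + 1"] by simp
  qed
  moreover have "z' i = z j"
  proof -
    have len: "start z j' = start z j + b + N (z j)" using \<open>j' = j + 1\<close> by (simp add: start_Suc)
    have "N (z j) \<ge> 100 * b" by (rule N_ge)
    moreover have "\<not> 2 * N (z' i) \<le> N (z j)" using len D J3 s1 N' b_ge by argo
    moreover have "\<not> 2 * N (z j) \<le> N (z' i)" using len D J3 s1 N' b_ge calculation(1) by argo
    ultimately show ?thesis using N_double by (metis linorder_neqE_nat)
  qed
  ultimately show ?thesis by simp
qed

text \<open>By \<open>code_step\<close> the index map \<open>J\<close> grows by exactly one per
  block, so it is a translation.\<close>

lemma code_match:
  assumes "track z k y" "track z' k' y"
  shows "\<exists>c. z' = shiftn c z \<and> \<bar>k (inv k' 0) - start z c\<bar> \<le> 2 * b"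
proof -
  obtain J where J: "\<And>i. \<bar>k (inv k' (start z' i)) - start z (J i)\<bar> \<le> 2 * b"
    using recognize_track[OF assms] by metis
  have step: "J (i + 1) = J i + 1" "z' i = z (J i)" for i
    using code_step[OF assms J[of i] J[of "i + 1"]] by auto
  have J_lin: "J i = i + J 0" for i
  proof (induction i rule: int_induct[where k = 0])
    case (step2 i)
    then show ?case using step(1)[of "i - 1"] by simp
  qed (use step in auto)
  have "z' i = shiftn (J 0) z i" for i
    using step(2)[of i] unfolding shiftn_def J_lin[of i] .
  then have "z' = shiftn (J 0) z" ..
  moreover have "\<bar>k (inv k' 0) - start z (J 0)\<bar> \<le> 2 * b" using J[of 0] by simp
  ultimately show ?thesis by blast
qed

lemma S_match:
  assumes "track z k y" "(z', \<phi> u y) \<in> S"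
  shows "\<exists>c. z' = shiftn c z \<and> \<bar>k u - start z c\<bar> \<le> 2 * b"
proof -
  obtain k' where k': "track z' k' (\<phi> u y)" "k' 0 = 0" using assms(2) by (auto simp: S_track)
  have t: "track z' (\<lambda>t. k' (t - u)) y"
    using track_shiftn[OF k'(1), of 0 "-u"] by (simp add: flow_add)
  have "inv (\<lambda>t. k' (t - u)) 0 = u"
    using time_change_inv(3)[OF track_time_change[OF t], where t = u] k'(2) by simp
  then show ?thesis using code_match[OF assms(1) t] by simp
qed

text \<open>Both points code \<open>z\<close>, so the shift between them fixes \<open>z\<close> and
  is trivial by aperiodicity. The second point is then within \<open>2 * b\<close> of the start of
  block 0 on the clock of the first, and 5/2 is 2 times 5/4.\<close>

lemma S_self:
  assumes "(z, y) \<in> S" "(z, \<phi> u y) \<in> S"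
  shows "\<bar>u\<bar> \<le> 5/2 * b"
proof -
  obtain k where k: "track z k y" "k 0 = 0" using assms(1) by (auto simp: S_track)
  obtain c where c: "z = shiftn c z" "\<bar>k u - start z c\<bar> \<le> 2 * b" using S_match[OF k(1) assms(2)] by blast
  have "c = 0" using c(1) aperiodic[of z c] k(1) by (simp add: track_def)
  then have "\<bar>k u\<bar> \<le> 2 * b" using c by simp
  then show ?thesis using time_change_abs(1)[OF track_time_change[OF k(1)], of u 0] k(2) by simp
qed

text \<open>Large multiples of a nonzero period would violate the bound in
  \<open>S_self\<close>.\<close>

lemma S_nonperiodic:
  assumes "(z, y) \<in> S" "\<phi> T y = y"
  shows "T = 0"
proof (rule ccontr)
  assume "T \<noteq> 0"
  have "\<exists>n. 5/2 * b < real n * \<bar>T\<bar>"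
    using reals_Archimedean3[of "\<bar>T\<bar>"] \<open>T \<noteq> 0\<close> zero_less_abs_iff by blast
  then obtain n where n: "5/2 * b < real n * \<bar>T\<bar>" by blast
  have "(z, \<phi> (real n * T) y) \<in> S" using flow_iterate[OF assms(2)] assms(1) by simp
  from S_self[OF assms(1) this] show False using n by (simp add: abs_mult)
qed

lemma S_shiftn:
  assumes "track z k y"
  shows "(shiftn n z, \<phi> (inv k (start z n)) y) \<in> S"
proof -
  have "k (inv k (start z n)) = start z n" using time_change_inv(2)[OF track_time_change[OF assms]] by simp
  then show ?thesis using track_shiftn[OF assms, of n "inv k (start z n)"] unfolding S_track by force
qed

lemma S_compact: "compact S"
  unfolding S_def
proof (rule compact_followers[OF \<Sigma>_compact])
  fix i :: int
  have "continuous_on UNIV (\<lambda>z::int \<Rightarrow> nat. z (i div 2))" by simp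
  then have "continuous_on UNIV (\<lambda>z::int \<Rightarrow> nat. N (z (i div 2)))"
    by (rule continuous_on_compose2[OF Topological_Spaces.continuous_on_discrete[of UNIV N]]) auto
  then show "continuous_on UNIV (\<lambda>z. dur z i)" by (cases "even i") (auto simp: dur_def)
qed auto

section \<open>Continuous choice of a base point on each coded orbit\<close>

definition S0 :: "'a set" where "S0 = snd ` S"

text \<open>A point of \<open>S0\<close> runs through its marker in time at most
  \<open>5/4 * b\<close>, so closeness during \<open>2 * b\<close> covers the whole marker.\<close>

definition \<beta> :: real where
  "\<beta> = (SOME \<beta>. \<beta> > 0 \<and> (\<forall>y z t. dist y z < \<beta> \<longrightarrow> \<bar>t\<bar> \<le> 2 * b \<longrightarrow> dist (\<phi> t y) (\<phi> t z) < e))"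

lemma \<beta>: "\<beta> > 0" "dist y z < \<beta> \<Longrightarrow> \<bar>t\<bar> \<le> 2 * b \<Longrightarrow> dist (\<phi> t y) (\<phi> t z) < e"
proof -
  have "\<exists>\<beta>. \<beta> > 0 \<and> (\<forall>y z t. dist y z < \<beta> \<longrightarrow> \<bar>t\<bar> \<le> 2 * b \<longrightarrow> dist (\<phi> t y) (\<phi> t z) < e)"
    using flow_uniform[OF e_pos, of "2 * b"] by metis
  from someI_ex[OF this, folded \<beta>_def]
  show "\<beta> > 0" "dist y z < \<beta> \<Longrightarrow> \<bar>t\<bar> \<le> 2 * b \<Longrightarrow> dist (\<phi> t y) (\<phi> t z) < e" by auto
qed

text \<open>A point of \<open>S0\<close> follows its marker within \<open>e\<close>, so a point
  closer than \<open>\<beta>\<close> to it does so within \<open>2 * e\<close>, the accuracy that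
  \<open>recognize\<close> accepts.\<close>

lemma near_S0:
  assumes "track z k y" "infdist (\<phi> t y) S0 < \<beta>" "S0 \<noteq> {}"
  shows "\<exists>j. \<bar>k t - start z j\<bar> \<le> 2 * b"
proof -
  have "(INF a\<in>S0. dist (\<phi> t y) a) < \<beta>" using assms(2,3) by (simp add: infdist_notempty)
  moreover have "bdd_below (dist (\<phi> t y) ` S0)" by (rule bdd_belowI2[of _ 0]) simp
  ultimately obtain y' where y': "y' \<in> S0" "dist (\<phi> t y) y' < \<beta>"
    using cINF_less_iff[OF assms(3)] by blast
  obtain z' k' where k': "track z' k' y'" "k' 0 = 0" using y'(1) by (auto simp: S0_def S_track)
  note sk' = track_time_change[OF k'(1)]
  show ?thesis
  proof (rule recognize[OF assms(1) sk' k'(2)])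
    fix t' assume t': "0 < k' t'" "k' t' < b"
    have "dist (\<phi> t' y') (\<phi> (k' t') x) \<le> e" using track_even[OF k'(1), of 0 t'] t' by simp
    moreover have "\<bar>t'\<bar> \<le> 2 * b" using time_change_abs(1)[OF sk', of t' 0] k'(2) t' by simp
    then have "dist (\<phi> t' (\<phi> t y)) (\<phi> t' y') < e" using \<beta>(2) y'(2) by simp
    ultimately show "dist (\<phi> (t + t') y) (\<phi> (k' t') x) \<le> 2 * e"
      using dist_triangle[of "\<phi> (t + t') y" "\<phi> (k' t') x" "\<phi> t' y'"] by (simp add: flow_add)
  qed
qed

text \<open>The minimum of \<open>F y\<close> near 0 is a penalised version of the earliest time at which the orbit of
  \<^term>\<open>y\<close> visits \<^term>\<open>S0\<close> near 0.  Unlike that earliest time it depends continuously on \<^term>\<open>y\<close>,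
  and it changes by \<open>- u\<close> when \<^term>\<open>y\<close> is moved to \<open>\<phi> u y\<close>.\<close>
definition F :: "'a \<Rightarrow> real \<Rightarrow> real" where
  "F y t = t + 40 * b / \<beta> * infdist (\<phi> t y) S0"

text \<open>With the factor \<open>40 * b / \<beta>\<close>, a value at most
  \<open>F y 0 = 0\<close> inside the window forces distance at most \<open>\<beta> / 2\<close> to
  \<open>S0\<close>, so \<open>near_S0\<close> applies. The radius \<open>20 * b\<close> keeps the
  clock within \<open>25 * b\<close> of 0, and as blocks are at least \<open>101 * b\<close> long
  only the start of block 0 can be nearby. The minimisers therefore lie within
  \<open>5/2 * b\<close>, away from the ends of the window.\<close>

definition M :: "((int \<Rightarrow> nat) \<times> 'a \<times> real) set" where
  "M = {(z, y, t). (z, y) \<in> S \<and> t \<in> {-20 * b..20 * b} \<and> (\<forall>s\<in>{-20 * b..20 * b}. F y t \<le> F y s)}"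

lemma continuous_on_F [continuous_intros]:
  assumes "continuous_on A f" "continuous_on A g"
  shows "continuous_on A (\<lambda>z. F (f z) (g z))"
  unfolding F_def by (intro continuous_intros assms)

lemma M_exists:
  assumes "(z, y) \<in> S"
  shows "\<exists>t. (z, y, t) \<in> M"
proof -
  have "continuous_on {-20 * b..20 * b} (F y)"
    using continuous_on_F[OF continuous_on_const continuous_on_id] by simp
  then obtain t where "t \<in> {-20 * b..20 * b}" "\<forall>s\<in>{-20 * b..20 * b}. F y t \<le> F y s"
    using continuous_attains_inf[of "{-20 * b..20 * b}" "F y"] b_ge by auto
  then show ?thesis using assms by (auto simp: M_def)
qed

lemma M_bounds:
  assumes "(z, y, t) \<in> M"
  shows "\<bar>t\<bar> \<le> 5/2 * b" "-5/2 * b \<le> F y t" "F y t \<le> 0"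
proof -
  have m: "(z, y) \<in> S" "t \<in> {-20 * b..20 * b}" "\<And>s. s \<in> {-20 * b..20 * b} \<Longrightarrow> F y t \<le> F y s"
    using assms by (auto simp: M_def)
  have "y \<in> S0" using m(1) by (force simp: S0_def)
  then have "F y 0 = 0" by (simp add: F_def)
  then show F0: "F y t \<le> 0" using m(3)[of 0] b_ge by simp
  have ge: "t \<le> F y t" using b_ge \<beta>(1) infdist_nonneg[of "\<phi> t y" S0] by (simp add: F_def)
  have "40 * b / \<beta> * infdist (\<phi> t y) S0 \<le> 20 * b" using F0 m(2) by (simp add: F_def)
  then have "2 * infdist (\<phi> t y) S0 \<le> \<beta>" using b_ge \<beta>(1) by (simp add: field_simps)
  then have lt: "infdist (\<phi> t y) S0 < \<beta>" using \<beta>(1) by simp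
  obtain k where k: "track z k y" "k 0 = 0" using m(1) by (auto simp: S_track)
  obtain j where j: "\<bar>k t - start z j\<bar> \<le> 2 * b" using near_S0[OF k(1) lt] \<open>y \<in> S0\<close> by auto
  have "\<bar>k t\<bar> \<le> 5/4 * \<bar>t\<bar>" using time_change_abs(2)[OF track_time_change[OF k(1)], of t 0] k(2) by simp
  moreover have "\<bar>t\<bar> \<le> 20 * b" using m(2) by auto
  ultimately have "\<bar>start z j\<bar> \<le> 27 * b" using j by linarith
  then have "j = 0"
    using start_gap1[of 0 j z] start_gap1[of j 0 z] b_ge by (cases "j = 0") (auto simp: neq_iff)
  then show "\<bar>t\<bar> \<le> 5/2 * b" using j time_change_abs(1)[OF track_time_change[OF k(1)], of t 0] k(2) by simp
  then show "-5/2 * b \<le> F y t" using ge by linarith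
qed

text \<open>The identity \<open>F (\<phi> u y) t = F y (t + u) - u\<close> compares the two minima,
  since each minimiser, displaced by at most \<open>5/2 * b\<close>, still lies in the window of the
  other point.\<close>

lemma M_equivariant:
  assumes "(z, y, t) \<in> M" "(z, \<phi> u y, t') \<in> M"
  shows "F (\<phi> u y) t' = F y t - u"
proof -
  have S: "(z, y) \<in> S" "(z, \<phi> u y) \<in> S" using assms by (auto simp: M_def)
  have u: "\<bar>u\<bar> \<le> 5/2 * b" by (rule S_self[OF S])
  have t: "\<bar>t\<bar> \<le> 5/2 * b" "\<bar>t'\<bar> \<le> 5/2 * b" using M_bounds(1) assms by blast+
  have range: "t - u \<in> {-20 * b..20 * b}" "t' + u \<in> {-20 * b..20 * b}"
    using u t b_ge unfolding abs_le_iff by auto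
  have "F (\<phi> u y) t' \<le> F (\<phi> u y) (t - u)" using assms(2) range(1) by (simp add: M_def)
  also have "\<dots> = F y t - u" by (simp add: F_def flow_add)
  finally have 1: "F (\<phi> u y) t' \<le> F y t - u" .
  have "F y t \<le> F y (t' + u)" using assms(1) range(2) by (simp add: M_def)
  also have "\<dots> = F (\<phi> u y) t' + u" by (simp add: F_def flow_add add.commute)
  finally show ?thesis using 1 by simp
qed

lemma M_unique:
  assumes "(z, y, t) \<in> M" "(z, y', t') \<in> M"
  shows "\<phi> (F y' t') y' = \<phi> (F y t) y"
proof -
  obtain k k' where "track z k y" "k 0 = 0" "track z k' y'" "k' 0 = 0"
    using assms by (auto simp: M_def S_track)
  then have "y' \<in> orbit \<phi> y"
    using same_orbit[of k k' z y y'] by (simp add: track_def base_def[abs_def] dur_def[abs_def])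
  then obtain u where "y' = \<phi> u y" by (auto simp: orbit_flow)
  then show ?thesis using M_equivariant[of z y t u t'] assms by (simp add: flow_add)
qed

text \<open>The flow time is the minimum value \<open>F y t\<close> and not the minimiser
  \<open>t\<close>: there may be several minimisers, but the value is unique, and its equivariance
  makes the resulting point independent of the follower \<open>y\<close>.\<close>

definition q :: "(int \<Rightarrow> nat) \<Rightarrow> 'a" where
  "q z = (SOME w. \<exists>y t. (z, y, t) \<in> M \<and> w = \<phi> (F y t) y)"

lemma q_eq:
  assumes "(z, y, t) \<in> M"
  shows "q z = \<phi> (F y t) y"
proof -
  have "\<exists>w. \<exists>y t. (z, y, t) \<in> M \<and> w = \<phi> (F y t) y" using assms by blast
  from someI_ex[OF this, folded q_def] show ?thesis using M_unique[OF assms] by auto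
qed

lemma S_exists: "z \<in> \<Sigma> \<Longrightarrow> \<exists>y k. track z k y \<and> k 0 = 0"
  using shadowed[of z] by (auto simp: track_def base_def[abs_def] dur_def[abs_def])

text \<open>The graph of \<open>q\<close> is a continuous image of the set of minimising triples,
  which is compact because minimality is a closed condition.\<close>

lemma q_continuous: "continuous_on \<Sigma> q"
proof (rule continuous_on_compact_graph[OF Hausdorff_sequences])
  define I where "I = {-20 * b..20 * b}"
  have "closed {v::((int \<Rightarrow> nat) \<times> 'a) \<times> real. \<forall>s\<in>I. F (snd (fst v)) (snd v) \<le> F (snd (fst v)) s}"
  proof -
    have "closed (\<Inter>s\<in>I. {v::((int \<Rightarrow> nat) \<times> 'a) \<times> real. F (snd (fst v)) (snd v) \<le> F (snd (fst v)) s})"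
      by (intro closed_INT ballI closed_Collect_le continuous_on_F continuous_on_fst continuous_on_snd
          continuous_on_id continuous_on_const)
    moreover have "(\<Inter>s\<in>I. {v::((int \<Rightarrow> nat) \<times> 'a) \<times> real. F (snd (fst v)) (snd v) \<le> F (snd (fst v)) s}) =
      {v. \<forall>s\<in>I. F (snd (fst v)) (snd v) \<le> F (snd (fst v)) s}" by auto
    ultimately show ?thesis by simp
  qed
  then have "compact ((S \<times> I) \<inter> {v. \<forall>s\<in>I. F (snd (fst v)) (snd v) \<le> F (snd (fst v)) s})"
    by (intro compact_Int_closed compact_Times S_compact) (simp add: I_def)
  then have "compact ((\<lambda>v. (fst (fst v), \<phi> (F (snd (fst v)) (snd v)) (snd (fst v)))) `
      ((S \<times> I) \<inter> {v. \<forall>s\<in>I. F (snd (fst v)) (snd v) \<le> F (snd (fst v)) s}))"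
    by (intro compact_continuous_image continuous_on_Pair continuous_on_flow continuous_on_F
        continuous_on_fst continuous_on_snd continuous_on_id)
  moreover have "(\<lambda>v. (fst (fst v), \<phi> (F (snd (fst v)) (snd v)) (snd (fst v)))) `
      ((S \<times> I) \<inter> {v. \<forall>s\<in>I. F (snd (fst v)) (snd v) \<le> F (snd (fst v)) s}) = {(z, q z) | z. z \<in> \<Sigma>}"
    (is "?f ` ?A = _")
  proof (intro equalityI subsetI)
    fix w assume "w \<in> ?f ` ?A"
    then obtain z y t where "w = (z, \<phi> (F y t) y)" "(z, y, t) \<in> M" by (auto simp: M_def I_def)
    moreover then have "z \<in> \<Sigma>" by (auto simp: M_def S_def)
    ultimately show "w \<in> {(z, q z) | z. z \<in> \<Sigma>}" using q_eq by auto
  next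
    fix w assume "w \<in> {(z, q z) | z. z \<in> \<Sigma>}"
    then obtain z where z: "w = (z, q z)" "z \<in> \<Sigma>" by auto
    obtain y where "(z, y) \<in> S" using S_exists[OF z(2)] by (auto simp: S_track)
    then obtain t where t: "(z, y, t) \<in> M" using M_exists by blast
    then have "w = ?f ((z, y), t)" using z q_eq by simp
    moreover have "((z, y), t) \<in> ?A" using t by (simp add: M_def I_def)
    ultimately show "w \<in> ?f ` ?A" by blast
  qed
  ultimately show "compact {(z, q z) | z. z \<in> \<Sigma>}" by simp
qed

text \<open>The section point of block \<open>n\<close> comes at most \<open>5/2 * b\<close> before
  the time \<open>\<tau> n\<close> at which the block starts. A gap of \<open>101 * b\<close> on the
  clock is at least \<open>80 * b\<close> in orbit time, so more than \<open>75 * b\<close> remains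
  after this correction.\<close>

lemma q_on_orbit:
  assumes "track z k y" "k 0 = 0"
  obtains \<theta> where "\<And>n. q (shiftn n z) = \<phi> (\<theta> n) y"
    "\<And>i j. i < j \<Longrightarrow> \<theta> i + 75 * b \<le> \<theta> j"
    "\<theta> 1 \<le> \<theta> 0 + 5/4 * (b + Nmax) + 5 * b"
proof -
  define \<tau> where "\<tau> = (\<lambda>n. inv k (start z n))"
  have "\<exists>t. (shiftn n z, \<phi> (\<tau> n) y, t) \<in> M" for n
    unfolding \<tau>_def by (rule M_exists[OF S_shiftn[OF assms(1)]])
  then obtain t where t: "\<And>n. (shiftn n z, \<phi> (\<tau> n) y, t n) \<in> M" by metis
  define \<theta> where "\<theta> = (\<lambda>n. \<tau> n + F (\<phi> (\<tau> n) y) (t n))"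
  have "q (shiftn n z) = \<phi> (\<theta> n) y" for n
    using q_eq[OF t[of n]] by (simp add: \<theta>_def flow_add)
  moreover have b1: "\<tau> n - 5/2 * b \<le> \<theta> n" "\<theta> n \<le> \<tau> n" for n
    using M_bounds(2,3)[OF t[of n]] by (auto simp: \<theta>_def)
  note inv = time_change_inv[OF track_time_change[OF assms(1)]]
  have k\<tau>: "k (\<tau> n) = start z n" for n using inv by (simp add: \<tau>_def)
  have "\<theta> i + 75 * b \<le> \<theta> j" if "i < j" for i j
  proof -
    have g: "start z i + 101 * b \<le> start z j" using start_gap1[OF that] .
    then have "\<tau> i \<le> \<tau> j"
      using k\<tau> time_change_le_iff[OF track_time_change[OF assms(1)], of "\<tau> i" "\<tau> j"] b_ge by simp
    then have "101 * b \<le> 5/4 * (\<tau> j - \<tau> i)"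
      using time_changeD(2)[OF track_time_change[OF assms(1)], of "\<tau> i" "\<tau> j"] k\<tau> g by simp
    then show ?thesis using b1(1)[of j] b1(2)[of i] b_ge by argo
  qed
  moreover have "\<theta> 1 \<le> \<theta> 0 + 5/4 * (b + Nmax) + 5 * b"
  proof -
    have z: "z \<in> \<Sigma>" using assms(1) by (simp add: track_def)
    have "start z 1 \<le> b + Nmax" using start_Suc[of z 0] N_le[OF z, of 0] by simp
    moreover have "\<bar>\<tau> 1 - \<tau> 0\<bar> \<le> 5/4 * \<bar>start z 1 - start z 0\<bar>"
      using time_change_abs(1)[OF track_time_change[OF assms(1)], of "\<tau> 1" "\<tau> 0"] k\<tau> by simp
    moreover have "start z 1 \<ge> 0" using start_gap1[of 0 1 z] b_ge by simp
    ultimately have "\<tau> 1 - \<tau> 0 \<le> 5/4 * (b + Nmax)"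
      using abs_ge_self[of "\<tau> 1 - \<tau> 0"] by simp
    then show ?thesis using b1(2)[of 1] b1(1)[of 0] b_ge by argo
  qed
  ultimately show ?thesis using that by blast
qed

section \<open>The return time and the resulting suspension\<close>

definition r :: "(int \<Rightarrow> nat) \<Rightarrow> real" where
  "r z = (THE u. q (shift z) = \<phi> u (q z))"

text \<open>The description in \<open>r\<close> is unique since an orbit through \<open>S\<close> is
  not periodic. The upper bound places the graph of \<open>r\<close> in a compact product, where it
  is the zero set of a continuous function.\<close>

lemma r_props:
  assumes "z \<in> \<Sigma>"
  shows "q (shift z) = \<phi> u (q z) \<longleftrightarrow> u = r z" "r z > 0" "r z \<le> 5/4 * (b + Nmax) + 5 * b"
proof -
  obtain y k where k: "track z k y" "k 0 = 0" using S_exists[OF assms] by blast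
  obtain \<theta> where \<theta>: "\<And>n. q (shiftn n z) = \<phi> (\<theta> n) y"
    "\<And>i j. i < j \<Longrightarrow> \<theta> i + 75 * b \<le> \<theta> j" "\<theta> 1 \<le> \<theta> 0 + 5/4 * (b + Nmax) + 5 * b"
    using q_on_orbit[OF k] by blast
  have S: "(z, y) \<in> S" using k by (auto simp: S_track)
  have q0: "q z = \<phi> (\<theta> 0) y" "q (shift z) = \<phi> (\<theta> 1) y"
    using \<theta>(1)[of 0] \<theta>(1)[of 1] by (auto simp: shift_def)
  have iff: "q (shift z) = \<phi> v (q z) \<longleftrightarrow> v = \<theta> 1 - \<theta> 0" for v
  proof
    assume "q (shift z) = \<phi> v (q z)"
    then have "\<phi> (\<theta> 1) y = \<phi> (\<theta> 0 + v) y" using q0 by (simp add: flow_add)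
    from S_nonperiodic[OF S flow_cancel[OF this]] have "\<theta> 0 + v - \<theta> 1 = 0" .
    then show "v = \<theta> 1 - \<theta> 0" by simp
  qed (use q0 in \<open>simp add: flow_add\<close>)
  then have r: "r z = \<theta> 1 - \<theta> 0" by (simp add: r_def)
  show "q (shift z) = \<phi> u (q z) \<longleftrightarrow> u = r z" "r z > 0" "r z \<le> 5/4 * (b + Nmax) + 5 * b"
    using iff r \<theta>(2)[of 0 1] \<theta>(3) b_ge by auto
qed

lemma r_continuous: "continuous_on \<Sigma> r"
proof (rule continuous_on_compact_graph[OF Hausdorff_sequences])
  define I where "I = {0..5/4 * (b + Nmax) + 5 * b}"
  have C: "compact (\<Sigma> \<times> I)" unfolding I_def by (intro compact_Times \<Sigma>_compact compact_Icc)
  have sh: "continuous_on UNIV shift"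
    unfolding shift_def shiftn_def
    by (rule continuous_on_coordinatewise_then_product) simp
  have q1: "continuous_on (\<Sigma> \<times> I) (\<lambda>v. q (shift (fst v)))"
  proof (rule continuous_on_compose2[OF q_continuous])
    show "continuous_on (\<Sigma> \<times> I) (\<lambda>v. shift (fst v))"
      by (rule continuous_on_compose2[OF sh]) (auto intro: continuous_on_fst continuous_on_id)
    show "(\<lambda>v. shift (fst v)) ` (\<Sigma> \<times> I) \<subseteq> \<Sigma>" using \<Sigma>_shift by auto
  qed
  have q2: "continuous_on (\<Sigma> \<times> I) (\<lambda>v. q (fst v))"
    by (rule continuous_on_compose2[OF q_continuous]) (auto intro: continuous_on_fst continuous_on_id)
  have "continuous_on (\<Sigma> \<times> I) (\<lambda>v. dist (q (shift (fst v))) (\<phi> (snd v) (q (fst v))))"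
    by (intro continuous_on_dist q1 continuous_on_flow q2 continuous_on_snd continuous_on_id)
  from continuous_closedin_preimage[OF this, of "{0}"]
  have "compact ((\<Sigma> \<times> I) \<inter> (\<lambda>v. dist (q (shift (fst v))) (\<phi> (snd v) (q (fst v)))) -` {0})"
    by (intro closedin_compact[OF C]) simp
  moreover have "(\<Sigma> \<times> I) \<inter> (\<lambda>v. dist (q (shift (fst v))) (\<phi> (snd v) (q (fst v)))) -` {0} = {(z, r z) | z. z \<in> \<Sigma>}"
    using r_props by (force simp: I_def less_imp_le)
  ultimately show "compact {(z, r z) | z. z \<in> \<Sigma>}" by simp
qed

text \<open>If \<open>q z'\<close> lies on the orbit of \<open>q z\<close>, then \<open>z'\<close>
  is the shift of \<open>z\<close> by some \<open>c\<close>. The times \<open>\<theta> n\<close>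
  increase strictly, and \<open>\<theta> c\<close> is at least \<open>\<theta> 0\<close> and less
  than \<open>\<theta> 1\<close>, so \<open>c = 0\<close>.\<close>

lemma q_injective:
  assumes "z \<in> \<Sigma>" "z' \<in> \<Sigma>" "0 \<le> u" "u < r z" "\<phi> u (q z) = q z'"
  shows "u = 0 \<and> z' = z"
proof -
  obtain y k where k: "track z k y" "k 0 = 0" using S_exists[OF assms(1)] by blast
  obtain \<theta> where \<theta>: "\<And>n. q (shiftn n z) = \<phi> (\<theta> n) y"
    "\<And>i j. i < j \<Longrightarrow> \<theta> i + 75 * b \<le> \<theta> j" "\<theta> 1 \<le> \<theta> 0 + 5/4 * (b + Nmax) + 5 * b"
    using q_on_orbit[OF k] by blast
  obtain y' k' where k': "track z' k' y'" "k' 0 = 0" using S_exists[OF assms(2)] by blast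
  obtain \<theta>' where \<theta>': "\<And>n. q (shiftn n z') = \<phi> (\<theta>' n) y'"
    "\<And>i j. i < j \<Longrightarrow> \<theta>' i + 75 * b \<le> \<theta>' j" "\<theta>' 1 \<le> \<theta>' 0 + 5/4 * (b + Nmax) + 5 * b"
    using q_on_orbit[OF k'] by blast
  have S: "(z, y) \<in> S" "(z', y') \<in> S" using k k' by (auto simp: S_track)
  have q0: "q z = \<phi> (\<theta> 0) y" "q z' = \<phi> (\<theta>' 0) y'" using \<theta>(1)[of 0] \<theta>'(1)[of 0] by auto
  then have "\<phi> (\<theta>' 0) y' = \<phi> (\<theta> 0 + u) y" using assms(5) by (simp add: flow_add)
  then have "y' = \<phi> (\<theta> 0 + u - \<theta>' 0) y"
    using flow_add[of "- \<theta>' 0" "\<theta>' 0" y'] by (simp add: flow_add)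
  then obtain c where c: "z' = shiftn c z" using S_match[OF k(1)] S(2) by metis
  have "\<phi> (\<theta> c) y = \<phi> (\<theta> 0 + u) y" using \<theta>(1)[of c] c assms(5) q0 by (simp add: flow_add)
  from S_nonperiodic[OF S(1) flow_cancel[OF this]] have \<theta>c: "\<theta> c = \<theta> 0 + u" by simp
  have "q (shift z) = \<phi> (\<theta> 1 - \<theta> 0) (q z)"
    using \<theta>(1)[of 1] q0 by (simp add: shift_def flow_add)
  then have "r z = \<theta> 1 - \<theta> 0" using r_props(1)[OF assms(1)] by simp
  then have lt: "\<theta> c < \<theta> 1" using \<theta>c assms(4) by simp
  have "\<not> c < 0" using \<theta>(2)[of c 0] \<theta>c assms(3) b_ge by auto
  moreover have "\<not> 1 < c" using \<theta>(2)[of 1 c] lt b_ge by auto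
  ultimately have "c = 0" using lt by (cases "c = 1") auto
  then show ?thesis using c \<theta>c by simp
qed

lemma horseshoe_suspension:
  "\<exists>Y r. closed Y \<and> (\<forall>t. \<phi> t ` Y = Y) \<and> continuous_on \<Sigma> r \<and> (\<forall>z\<in>\<Sigma>. r z > 0) \<and>
    conj_to_suspension \<phi> Y \<Sigma> r"
proof -
  have "\<exists>Y. closed Y \<and> (\<forall>t. \<phi> t ` Y = Y) \<and> conj_to_suspension \<phi> Y \<Sigma> r"
    by (rule suspension_conjugacy[OF \<Sigma>_compact \<Sigma>_shift q_continuous r_continuous])
       (use r_props(1,2) q_injective in blast)+
  then show ?thesis using r_continuous r_props(2) by blast
qed

end

subsection \<open>A subshift of positive entropy without periodic points\<close>

text \<open>Fekete's lemma. Because \<open>subshift_entropy\<close> is defined by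
  \<open>lim\<close>, its value can be estimated only once convergence is known.\<close>

lemma subadditive_converges:
  fixes a :: "nat \<Rightarrow> real"
  assumes sub: "\<And>m n. a (m + n) \<le> a m + a n" and nonneg: "\<And>n. a n \<ge> 0"
  shows "convergent (\<lambda>n. a (Suc n) / Suc n)"
proof -
  define L where "L = (INF n. a (Suc n) / Suc n)"
  have bdd: "bdd_below (range (\<lambda>n. a (Suc n) / Suc n))"
    using nonneg by (intro bdd_belowI2[of _ 0]) auto
  have lower: "L \<le> a (Suc n) / Suc n" for n unfolding L_def by (rule cINF_lower[OF bdd]) simp
  have mult: "a (q * m + r) \<le> real q * a m + a r" for q m r
  proof (induction q)
    case (Suc q)
    have "a (Suc q * m + r) \<le> a m + a (q * m + r)" using sub[of m "q * m + r"] by (simp add: add.assoc)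
    then show ?case using Suc by (simp add: algebra_simps)
  qed simp
  have "(\<lambda>n. a (Suc n) / Suc n) \<longlonglongrightarrow> L"
  proof (rule LIMSEQ_I)
    fix \<epsilon> :: real assume "\<epsilon> > 0"
    then have "(INF n. a (Suc n) / Suc n) < L + \<epsilon> / 2" by (simp add: L_def)
    then obtain m' where "a (Suc m') / Suc m' < L + \<epsilon> / 2"
      using cINF_less_iff[OF _ bdd] by blast
    then obtain m where m: "m > 0" "a m / m < L + \<epsilon> / 2" by blast
    \<comment> \<open>\<open>C\<close> bounds the term left over after division by \<open>m\<close>;
      from \<open>n0\<close> on its share of the average is below
      \<open>\<epsilon> / 2\<close>.\<close>
    define C where "C = (\<Sum>r<m. a r)"
    have C: "a r \<le> C" if "r < m" for r
      unfolding C_def using that nonneg by (intro member_le_sum) auto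
    obtain n0 :: nat where n0: "C < real n0 * (\<epsilon> / 2)"
      using ex_less_of_nat_mult[of "\<epsilon> / 2" C] \<open>\<epsilon> > 0\<close> by auto
    have "norm (a (Suc n) / Suc n - L) < \<epsilon>" if "n \<ge> n0" for n
    proof -
      define k where "k = Suc n"
      have k: "k > 0" by (simp add: k_def)
      have "real (k div m * m) \<le> real k" by (simp only: of_nat_le_iff div_times_less_eq_dividend)
      then have "real (k div m) \<le> real k / real m" using m(1) by (simp add: field_simps)
      then have "real (k div m) * a m \<le> real k / real m * a m"
        using nonneg by (intro mult_right_mono)
      moreover have "a k \<le> real (k div m) * a m + a (k mod m)"
        using mult[of "k div m" m "k mod m"] by simp
      moreover have "a (k mod m) \<le> C" using C m(1) by simp
      ultimately have "a k \<le> real k * (a m / m) + C" by simp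
      moreover have "real k * (a m / m) < real k * (L + \<epsilon> / 2)"
        using m(2) k by (intro mult_strict_left_mono) auto
      moreover have "C < real k * (\<epsilon> / 2)"
      proof -
        have "real n0 * (\<epsilon> / 2) \<le> real k * (\<epsilon> / 2)"
          using that \<open>\<epsilon> > 0\<close> by (intro mult_right_mono) (auto simp: k_def)
        then show ?thesis using n0 by simp
      qed
      ultimately have "a k < real k * (L + \<epsilon>)" by (simp add: algebra_simps)
      then have "a k / k < L + \<epsilon>" using k by (simp add: field_simps)
      then show ?thesis using lower[of n] by (simp add: k_def abs_less_iff)
    qed
    then show "\<exists>n0. \<forall>n\<ge>n0. norm (a (Suc n) / Suc n - L) < \<epsilon>" by blast
  qed
  then show ?thesis by (rule convergentI)
qed

lemma subshift_words:
  assumes "subshift A \<Sigma>"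
  shows "finite (words n \<Sigma>)" "card (words (m + n) \<Sigma>) \<le> card (words m \<Sigma>) * card (words n \<Sigma>)"
proof -
  have fin: "finite (words k \<Sigma>)" for k
  proof (rule finite_subset)
    show "words k \<Sigma> \<subseteq> {w. set w \<subseteq> A \<and> length w = k}"
      using assms by (auto simp: words_def subshift_def)
    show "finite {w. set w \<subseteq> A \<and> length w = k}"
      using assms by (intro finite_lists_length_eq) (simp add: subshift_def)
  qed
  then show "finite (words n \<Sigma>)" .
  have "words (m + n) \<Sigma> \<subseteq> (\<lambda>(u, v). u @ v) ` (words m \<Sigma> \<times> words n \<Sigma>)"
  proof
    fix w assume "w \<in> words (m + n) \<Sigma>"
    then obtain \<omega> where \<omega>: "\<omega> \<in> \<Sigma>" "w = map (\<lambda>k. \<omega> (int k)) [0..<m + n]"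
      by (auto simp: words_def)
    have "shift ` \<Sigma> = \<Sigma>" using assms by (simp add: subshift_def)
    then have sh: "shiftn (int m) \<omega> \<in> \<Sigma>" using \<omega>(1) by (rule shiftn_mem)
    have "[0..<m + n] = [0..<m] @ map (\<lambda>k. k + m) [0..<n]"
      by (simp add: map_add_upt upt_add_eq_append[of 0 m n] add.commute)
    then have "w = map (\<lambda>k. \<omega> (int k)) [0..<m] @ map (\<lambda>k. shiftn (int m) \<omega> (int k)) [0..<n]"
      using \<omega>(2) by (simp add: shiftn_def o_def)
    then show "w \<in> (\<lambda>(u, v). u @ v) ` (words m \<Sigma> \<times> words n \<Sigma>)"
      using \<omega>(1) sh by (auto simp: words_def image_iff)
  qed
  then have "card (words (m + n) \<Sigma>) \<le> card ((\<lambda>(u, v). u @ v) ` (words m \<Sigma> \<times> words n \<Sigma>))"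
    using fin by (intro card_mono) auto
  also have "\<dots> \<le> card (words m \<Sigma> \<times> words n \<Sigma>)" using fin by (intro card_image_le) auto
  finally show "card (words (m + n) \<Sigma>) \<le> card (words m \<Sigma>) * card (words n \<Sigma>)"
    by (simp add: card_cartesian_product)
qed

lemma subshift_entropy_pos:
  assumes "subshift A \<Sigma>" "\<And>n. 2 ^ n \<le> card (words n \<Sigma>)"
  shows "subshift_entropy \<Sigma> > 0"
proof -
  define a where "a = (\<lambda>n. ln (real (card (words n \<Sigma>))))"
  have card_pos: "card (words n \<Sigma>) > 0" for n
    using assms(2)[of n] by (metis less_le_trans zero_less_numeral zero_less_power)
  have lower: "real n * ln 2 \<le> a n" for n
  proof -
    have "real (2 ^ n) \<le> real (card (words n \<Sigma>))" using assms(2) of_nat_le_iff by blast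
    then have "ln (2 ^ n) \<le> a n" unfolding a_def by (subst ln_le_cancel_iff) (auto simp: card_pos)
    then show ?thesis by (simp add: ln_realpow)
  qed
  have "a n \<ge> 0" for n using lower[of n] by (smt (verit) ln_ge_zero of_nat_0_le_iff zero_le_mult_iff)
  moreover have "a (m + n) \<le> a m + a n" for m n
  proof -
    have "real (card (words (m + n) \<Sigma>)) \<le> real (card (words m \<Sigma>)) * real (card (words n \<Sigma>))"
      using subshift_words(2)[OF assms(1), of m n] of_nat_mono by fastforce
    then have "a (m + n) \<le> ln (real (card (words m \<Sigma>)) * real (card (words n \<Sigma>)))"
      unfolding a_def using card_pos by (subst ln_le_cancel_iff) auto
    then show ?thesis using card_pos by (simp add: a_def ln_mult)
  qed
  ultimately have "convergent (\<lambda>n. a (Suc n) / Suc n)" by (intro subadditive_converges)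
  then have "(\<lambda>n. a (Suc n) / Suc n) \<longlonglongrightarrow> subshift_entropy \<Sigma>"
    by (simp add: convergent_LIMSEQ_iff subshift_entropy_def a_def)
  moreover have "ln 2 \<le> a (Suc n) / Suc n" for n
    using lower[of "Suc n"] by (simp add: field_simps)
  ultimately have "ln 2 \<le> subshift_entropy \<Sigma>" by (intro LIMSEQ_le_const) auto
  then show ?thesis by (smt (verit) ln_gt_zero)
qed

text \<open>Symbols carry two bits: the low bits form an aperiodic sequence, with a bound on the place where
  every period \<open>s\<close> fails so that the condition is closed, while the high bits are free.\<close>
definition two_bit_shift :: "(int \<Rightarrow> nat) set" where
  "two_bit_shift = {z. (\<forall>i. z i \<in> {..3}) \<and>
     (\<forall>s\<ge>1. \<forall>i. \<exists>n\<in>{i..i + 4 * s}. even (z n) \<noteq> even (z (n + s)))}"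

lemma two_bit_subshift: "subshift {..3} two_bit_shift"
proof -
  have op: "open {z::int \<Rightarrow> nat. P (z n)}" for P n
  proof -
    have "continuous_on UNIV (\<lambda>z::int \<Rightarrow> nat. z n)" by simp
    then have "open ((\<lambda>z::int \<Rightarrow> nat. z n) -` {m. P m})" by (intro open_vimage open_discrete)
    then show ?thesis by (simp add: vimage_def)
  qed
  have clopen: "closed {z::int \<Rightarrow> nat. P (z n)}" for P n
    using closed_Collect_neg[OF op[of "\<lambda>m. \<not> P m" n]] by simp
  have "closed {z::int \<Rightarrow> nat. even (z n) \<noteq> even (z m)}" for n m
  proof -
    have "{z::int \<Rightarrow> nat. even (z n) \<noteq> even (z m)} =
        {z. even (z n)} \<inter> {z. odd (z m)} \<union> {z. odd (z n)} \<inter> {z. even (z m)}" by auto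
    moreover have "closed ({z::int \<Rightarrow> nat. even (z n)} \<inter> {z. odd (z m)} \<union> {z. odd (z n)} \<inter> {z. even (z m)})"
      using clopen[of even] clopen[of odd] by (intro closed_Un closed_Int)
    ultimately show ?thesis by simp
  qed
  moreover have "closed {z::int \<Rightarrow> nat. z i \<in> {..3}}" for i
    using clopen[of "\<lambda>m. m \<in> {..3}" i] .
  ultimately have "closed ((\<Inter>i. {z::int \<Rightarrow> nat. z i \<in> {..3}}) \<inter>
      (\<Inter>s\<in>{1..}. \<Inter>i. \<Union>n\<in>{i..i + 4 * s}. {z. even (z n) \<noteq> even (z (n + s))}))"
    by (intro closed_Int closed_INT closed_UN ballI) auto
  moreover have "(\<Inter>i. {z::int \<Rightarrow> nat. z i \<in> {..3}}) \<inter>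
      (\<Inter>s\<in>{1..}. \<Inter>i. \<Union>n\<in>{i..i + 4 * s}. {z. even (z n) \<noteq> even (z (n + s))}) = two_bit_shift"
    by (auto simp: two_bit_shift_def)
  ultimately have "closed two_bit_shift" by simp
  have sh: "shiftn c z \<in> two_bit_shift" if z: "z \<in> two_bit_shift" for c z
  proof -
    have "\<exists>n\<in>{i..i + 4 * s}. even (shiftn c z n) \<noteq> even (shiftn c z (n + s))" if s: "s \<ge> 1" for s i
    proof -
      obtain n where "n \<in> {i + c..i + c + 4 * s}" "even (z n) \<noteq> even (z (n + s))"
        using z s unfolding two_bit_shift_def by blast
      then show ?thesis by (intro bexI[of _ "n - c"]) (auto simp: shiftn_def algebra_simps)
    qed
    then show ?thesis using z by (simp add: two_bit_shift_def shiftn_def)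
  qed
  have "shift ` two_bit_shift = two_bit_shift"
  proof (intro equalityI subsetI)
    fix z assume "z \<in> two_bit_shift"
    then have "shiftn (-1) z \<in> two_bit_shift" by (rule sh)
    moreover have "z = shift (shiftn (-1) z)" by (simp add: shift_def shiftn_add)
    ultimately show "z \<in> shift ` two_bit_shift" by blast
  qed (use sh in \<open>auto simp: shift_def\<close>)
  then show ?thesis using \<open>closed two_bit_shift\<close> by (auto simp: subshift_def two_bit_shift_def)
qed

lemma subshift_compact:
  assumes "subshift A \<Sigma>"
  shows "compact \<Sigma>"
proof -
  have "compact ({z. \<forall>i. z i \<in> A} \<inter> \<Sigma>)"
    using assms by (intro compact_Int_closed compact_fun_box finite_imp_compact) (auto simp: subshift_def)
  moreover have "{z. \<forall>i. z i \<in> A} \<inter> \<Sigma> = \<Sigma>" using assms by (auto simp: subshift_def)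
  ultimately show ?thesis by simp
qed

lemma two_bit_aperiodic:
  assumes "z \<in> two_bit_shift" "shiftn n z = z"
  shows "n = 0"
proof -
  have no: "\<not> s \<ge> 1" if "shiftn s z = z" for s
  proof
    assume "s \<ge> 1"
    then obtain m where "even (z m) \<noteq> even (z (m + s))"
      using assms(1) unfolding two_bit_shift_def by blast
    moreover have "z (m + s) = z m" using that by (metis shiftn_def)
    ultimately show False by simp
  qed
  have "shiftn (-n) z = shiftn (-n) (shiftn n z)" using assms(2) by simp
  then have "shiftn (-n) z = z" by (simp add: shiftn_add)
  then show ?thesis using no[of n] no[of "-n"] assms(2) by simp
qed

text \<open>For \<open>s = 2 ^ k * m\<close> with \<open>m\<close> odd, some \<open>n\<close> of 2-adic valuation \<open>k\<close> has \<open>n + s\<close> of valuation \<open>k + 1\<close>.\<close>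
lemma period_doubling_aperiodic:
  fixes s i :: int
  assumes "s \<ge> 1"
  shows "\<exists>n\<in>{i..i + 4 * s}. even (multiplicity 2 n) \<noteq> even (multiplicity 2 (n + s))"
proof -
  have mult: "multiplicity 2 (2 ^ k * j) = k" if "odd j" for k and j :: int
  proof -
    have "j \<noteq> 0" "\<not> 2 dvd j" using that by auto
    then show ?thesis
      using multiplicity_prime_elem_times_other by (simp add: prime_elem_multiplicity_mult_distrib not_dvd_imp_multiplicity_0)
  qed
  define k where "k = multiplicity 2 s"
  obtain m where m: "s = 2 ^ k * m" "odd m"
    using multiplicity_decompose'[of s 2] assms unfolding k_def by auto
  \<comment> \<open>Both valuations are determined modulo \<open>2 ^ (k + 2)\<close>:
    \<open>n\<close> is chosen congruent to \<open>2 ^ k * (2 - m)\<close>, which makes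
    \<open>n + s\<close> congruent to \<open>2 ^ (k + 1)\<close>. Such an \<open>n\<close> exists
    among any \<open>P\<close> consecutive integers, and \<open>P = 4 * 2 ^ k \<le> 4 * s\<close> is
    the origin of the bound \<open>4 * s\<close>.\<close>
  define P where "P = (2::int) ^ (k + 2)"
  have "P > 0" by (simp add: P_def)
  define n where "n = i + (2 ^ k * (2 - m) - i) mod P"
  have "m \<ge> 1" using m assms by (smt (verit) mult_nonneg_nonpos zero_le_power)
  then have "P \<le> 4 * s" using m(1) by (simp add: P_def)
  then have range: "n \<in> {i..i + 4 * s}"
    using pos_mod_bound[OF \<open>P > 0\<close>, of "2 ^ k * (2 - m) - i"]
      pos_mod_sign[OF \<open>P > 0\<close>, of "2 ^ k * (2 - m) - i"]
    unfolding n_def atLeastAtMost_iff by linarith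
  obtain l where "n = 2 ^ k * (2 - m) + P * l"
  proof
    show "n = 2 ^ k * (2 - m) + P * - ((2 ^ k * (2 - m) - i) div P)"
      using div_mult_mod_eq[of "2 ^ k * (2 - m) - i" P] by (simp add: n_def algebra_simps)
  qed
  then have n: "n = 2 ^ k * (2 - m + 4 * l)" "n + s = 2 ^ Suc k * (1 + 2 * l)"
    using m(1) by (simp_all add: P_def algebra_simps)
  have "multiplicity 2 n = k" unfolding n(1) by (rule mult) (use m in auto)
  moreover have "multiplicity 2 (n + s) = Suc k" unfolding n(2) by (rule mult) auto
  ultimately show ?thesis using range by (intro bexI[of _ n]) auto
qed

lemma two_bit_words: "2 ^ n \<le> card (words n two_bit_shift)"
proof -
  \<comment> \<open>The low bit at 0 is 0, as \<open>multiplicity 2 0 = 0\<close> by convention.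
    This does no harm: the positions compared in \<open>period_doubling_aperiodic\<close> are odd
    multiples of powers of 2.\<close>
  define z where "z = (\<lambda>B i. multiplicity 2 i mod 2 + (if i \<in> int ` B then 2 else (0::nat)))"
  have "z B \<in> two_bit_shift" for B
  proof -
    have "z B i \<le> 3" for i
      using mod_less_divisor[of 2 "multiplicity 2 i"] by (auto simp: z_def)
    moreover have "even (z B i) \<longleftrightarrow> even (multiplicity 2 i)" for i by (auto simp: z_def)
    ultimately show ?thesis using period_doubling_aperiodic by (simp add: two_bit_shift_def)
  qed
  then have "(\<lambda>B. map (\<lambda>k. z B (int k)) [0..<n]) ` Pow {..<n} \<subseteq> words n two_bit_shift"
    by (auto simp: words_def)
  moreover have "inj_on (\<lambda>B. map (\<lambda>k. z B (int k)) [0..<n]) (Pow {..<n})"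
  proof (rule inj_onI)
    fix B C assume BC: "B \<in> Pow {..<n}" "C \<in> Pow {..<n}"
      and "map (\<lambda>k. z B (int k)) [0..<n] = map (\<lambda>k. z C (int k)) [0..<n]"
    then have "z B (int k) = z C (int k)" if "k < n" for k using that by simp
    then have "k \<in> B \<longleftrightarrow> k \<in> C" if "k < n" for k
      using that by (force simp: z_def inj_image_mem_iff split: if_splits)
    then show "B = C" using BC by blast
  qed
  ultimately have "card (Pow {..<n}) \<le> card (words n two_bit_shift)"
    using subshift_words(1)[OF two_bit_subshift] by (intro card_inj_on_le)
  then show ?thesis by (simp add: card_Pow)
qed

subsection \<open>Recurrence, shadowing and expansivity\<close>

context compact_flow begin

text \<open>Matching the clocks by \<open>\<kappa>\<close> brings both orbits within
  \<open>e\<close> of the same point of the pseudo-orbit, so within \<open>2 * e\<close> of each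
  other. The hypothesis allows \<open>3 * e\<close> because \<open>recurrent_unfollowed\<close> uses
  expansivity at that scale.\<close>

lemma follows_same_orbit:
  assumes expansive: "\<And>y z \<kappa>. time_change (25/16) \<kappa> \<Longrightarrow> (\<And>t. dist (\<phi> t y) (\<phi> (\<kappa> t) z) \<le> 3 * e) \<Longrightarrow>
      dist y x \<le> e \<Longrightarrow> y \<in> orbit \<phi> z"
    and ts: "\<And>i. ts i \<ge> 1" and xs: "xs 0 = x" and "e > 0"
    and k: "time_change (5/4) k" "k 0 = 0" "follows \<phi> e xs ts k y"
    and k': "time_change (5/4) k'" "k' 0 = 0" "follows \<phi> e xs ts k' y'"
  shows "dist y x \<le> e" "y' \<in> orbit \<phi> y"
proof -
  have less: "ssum ts i < ssum ts (i + 1)" for i using ssum_step[of ts i] ts[of i] by simp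
  show yx: "dist y x \<le> e"
    using follows_closed_interval[OF k(3,1) _ less, of 0 0] k(2) xs less[of 0] by simp
  define \<kappa> where "\<kappa> = (\<lambda>t. inv k' (k t))"
  note inv' = time_change_inv[OF k'(1), simplified]
  have "time_change (25/16) \<kappa>" unfolding \<kappa>_def using time_change_compose[OF inv'(1) k(1)] by simp
  moreover have "dist (\<phi> t y) (\<phi> (\<kappa> t) y') \<le> 3 * e" for t
  proof -
    obtain i where i: "ssum ts i \<le> k t" "k t < ssum ts (i + 1)"
      using ssum_locate[of 1 ts "k t"] ts by auto
    have "k' (\<kappa> t) = k t" using inv' by (simp add: \<kappa>_def)
    then have "dist (\<phi> (\<kappa> t) y') (\<phi> (k t - ssum ts i) (xs i)) \<le> e"
      using follows_closed_interval[OF k'(3,1) _ less, of i "\<kappa> t"] i by simp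
    moreover have "dist (\<phi> t y) (\<phi> (k t - ssum ts i) (xs i)) \<le> e"
      using follows_closed_interval[OF k(3,1) _ less, of i t] i by simp
    ultimately show ?thesis
      using dist_triangle2[of "\<phi> t y" "\<phi> (\<kappa> t) y'" "\<phi> (k t - ssum ts i) (xs i)"] \<open>e > 0\<close> by linarith
  qed
  ultimately have "y \<in> orbit \<phi> y'" using expansive yx by blast
  moreover have "y' \<in> orbit \<phi> y'" unfolding orbit_flow by (rule exI[of _ 0]) simp
  ultimately show "y' \<in> orbit \<phi> y" using orbit_eq by blast
qed

text \<open>All followers of a periodic pseudo-orbit lie on one orbit, which is therefore a compact set.\<close>
lemma loop_follower_periodic:
  assumes expansive: "\<And>y z \<kappa>. time_change (25/16) \<kappa> \<Longrightarrow> (\<And>t. dist (\<phi> t y) (\<phi> (\<kappa> t) z) \<le> 3 * e) \<Longrightarrow>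
      dist y x \<le> e \<Longrightarrow> y \<in> orbit \<phi> z"
    and "a \<ge> 1" "e > 0"
    and k: "time_change (5/4) k" "k 0 = 0" "follows \<phi> e (\<lambda>_. x) (\<lambda>_. a) k p"
  shows "\<exists>T>0. \<phi> T p = p"
proof -
  define S where "S = {y. \<exists>k. time_change (5/4) k \<and> k 0 = 0 \<and> follows \<phi> e (\<lambda>_. x) (\<lambda>_. a) k y}"
  have "compact {(\<omega>, y). \<omega> \<in> {0::real} \<and> (\<exists>k. time_change (5/4) k \<and> k 0 = 0 \<and> follows \<phi> e (\<lambda>_. x) (\<lambda>_. a) k y)}"
    by (rule compact_followers) auto
  then have "compact (snd ` {(\<omega>, y). \<omega> \<in> {0::real} \<and>
      (\<exists>k. time_change (5/4) k \<and> k 0 = 0 \<and> follows \<phi> e (\<lambda>_. x) (\<lambda>_. a) k y)})"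
    by (intro compact_continuous_image continuous_on_snd continuous_on_id)
  moreover have "snd ` {(\<omega>, y). \<omega> \<in> {0::real} \<and>
      (\<exists>k. time_change (5/4) k \<and> k 0 = 0 \<and> follows \<phi> e (\<lambda>_. x) (\<lambda>_. a) k y)} = S"
    by (auto simp: S_def image_iff)
  ultimately have "compact S" by simp
  have S_orbit: "y \<in> orbit \<phi> p" if y: "y \<in> S" for y
  proof -
    obtain k' where k': "time_change (5/4) k'" "k' 0 = 0" "follows \<phi> e (\<lambda>_. x) (\<lambda>_. a) k' y"
      using y by (auto simp: S_def)
    show ?thesis
      by (rule follows_same_orbit(2)[OF expansive _ _ \<open>e > 0\<close> k k']) (use \<open>a \<ge> 1\<close> in auto)
  qed
  \<comment> \<open>The orbit passes through \<open>S\<close> once per round of the loop, so each of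
    its points comes at most \<open>5/4 * a\<close> after such a passage.\<close>
  have "orbit \<phi> p = (\<lambda>v. \<phi> (fst v) (snd v)) ` ({0..5/4 * a} \<times> S)"
  proof (intro equalityI subsetI)
    fix w assume "w \<in> orbit \<phi> p"
    then obtain u where u: "w = \<phi> u p" by (auto simp: orbit_flow)
    obtain i where i: "ssum (\<lambda>_. a) i \<le> k u" "k u < ssum (\<lambda>_. a) (i + 1)"
      using ssum_locate[of a "\<lambda>_. a" "k u"] \<open>a \<ge> 1\<close> by auto
    define v where "v = inv k (ssum (\<lambda>_. a) i)"
    have kv: "k v = ssum (\<lambda>_. a) i" using time_change_inv(2)[OF k(1)] by (simp add: v_def)
    have "v \<le> u" using time_change_le_iff[OF k(1), of v u] kv i by simp
    moreover have "k u - k v \<le> a" using i kv by (simp add: ssum_step)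
    ultimately have uv: "u - v \<in> {0..5/4 * a}" using time_changeD(1)[OF k(1), of v u] by simp
    have "follows \<phi> e (\<lambda>_. x) (\<lambda>_. a) (\<lambda>t. k (t + v) - ssum (\<lambda>_. a) i) (\<phi> v p)"
      using follows_translate[OF k(3), where n = i and u = v] by simp
    then have "\<phi> v p \<in> S"
      unfolding S_def using time_change_translate[OF k(1), of v "ssum (\<lambda>_. a) i"] kv
      by (intro CollectI exI[of _ "\<lambda>t. k (t + v) - ssum (\<lambda>_. a) i"]) simp
    then have "(u - v, \<phi> v p) \<in> {0..5/4 * a} \<times> S" using uv by blast
    moreover have "w = (\<lambda>v. \<phi> (fst v) (snd v)) (u - v, \<phi> v p)" using u by (simp add: flow_add)
    ultimately show "w \<in> (\<lambda>v. \<phi> (fst v) (snd v)) ` ({0..5/4 * a} \<times> S)" by blast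
  next
    fix w assume "w \<in> (\<lambda>v. \<phi> (fst v) (snd v)) ` ({0..5/4 * a} \<times> S)"
    then obtain t y where w: "w = \<phi> t y" "y \<in> S" by auto
    obtain s where "y = \<phi> s p" using S_orbit[OF w(2)] by (auto simp: orbit_flow)
    then have "w = \<phi> (s + t) p" using w by (simp add: flow_add)
    then show "w \<in> orbit \<phi> p" by (auto simp: orbit_flow)
  qed
  moreover have "compact ((\<lambda>v. \<phi> (fst v) (snd v)) ` ({0..5/4 * a} \<times> S))"
    by (intro compact_continuous_image compact_Times compact_Icc \<open>compact S\<close> continuous_on_flow
        continuous_on_fst continuous_on_snd continuous_on_id)
  ultimately show ?thesis using compact_orbit_periodic by metis
qed

text \<open>Otherwise a recurrence argument makes the whole orbit of \<^term>\<open>x\<close> follow that of \<^term>\<open>p\<close>, and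
  \<^term>\<open>x\<close> would be periodic.\<close>
lemma recurrent_unfollowed:
  assumes expansive: "\<And>y z \<kappa>. time_change (25/16) \<kappa> \<Longrightarrow> (\<And>t. dist (\<phi> t y) (\<phi> (\<kappa> t) z) \<le> 3 * e) \<Longrightarrow>
      dist y x \<le> e \<Longrightarrow> y \<in> orbit \<phi> z"
    and recurrent: "\<And>\<epsilon> T. \<epsilon> > 0 \<Longrightarrow> \<exists>t\<ge>T. dist (\<phi> t x) x < \<epsilon>"
    and nonperiodic: "\<And>T. T > 0 \<Longrightarrow> \<phi> T x \<noteq> x"
    and "e > 0" and p: "T > 0" "\<phi> T p = p"
  shows "\<exists>L>0. \<forall>\<kappa>. time_change (25/16) \<kappa> \<longrightarrow> (\<exists>t. 0 < t \<and> t < L \<and> dist (\<phi> t x) (\<phi> (\<kappa> t) p) > 3 * e)"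
proof (rule ccontr)
  assume "\<not> ?thesis"
  then have follow: "\<exists>\<kappa>. time_change (25/16) \<kappa> \<and> (\<forall>t. 0 < t \<and> t < L \<longrightarrow> dist (\<phi> t x) (\<phi> (\<kappa> t) p) \<le> 3 * e)"
    if "L > 0" for L using that by (meson not_le)
  \<comment> \<open>Changing a time change by multiples of \<open>T\<close> does not alter what it
    follows; so its value at 0 can be brought into \<open>{0..T}\<close>, which leaves a compact set
    of candidates.\<close>
  have p_int: "\<phi> (s - of_int m * T) p = \<phi> s p" for s m
  proof -
    have nat: "\<phi> (real n * T) p = p" for n using flow_iterate[OF p(2)] .
    have neg: "\<phi> (- (real n * T)) p = p" for n using flow_cancel[of "real n * T" p 0] nat[of n] by simp
    have "\<phi> (- (of_int m * T)) p = p"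
    proof (cases "m \<ge> 0")
      case True
      then show ?thesis using neg[of "nat m"] by simp
    next
      case False
      then show ?thesis using nat[of "nat (- m)"] by simp
    qed
    then show ?thesis using flow_add[of s "- (of_int m * T)" p] by simp
  qed
  define K where "K = {k. time_change (25/16) k \<and> k 0 \<in> {0..T}}"
  define C where "C = (\<lambda>n::nat. {k::real \<Rightarrow> real. \<forall>t. \<bar>t\<bar> \<le> real n \<longrightarrow> dist (\<phi> t x) (\<phi> (k t) p) \<le> 3 * e + 1 / Suc n})"
  have C_mono: "C n \<subseteq> C m" if "m \<le> n" for m n
  proof
    fix k assume k: "k \<in> C n"
    have "1 / real (Suc n) \<le> 1 / real (Suc m)" using that by (intro divide_left_mono) auto
    show "k \<in> C m"
      unfolding C_def
    proof (intro CollectI allI impI)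
      fix t :: real assume "\<bar>t\<bar> \<le> real m"
      then have "\<bar>t\<bar> \<le> real n" using that by simp
      then have "dist (\<phi> t x) (\<phi> (k t) p) \<le> 3 * e + 1 / Suc n" using k unfolding C_def by blast
      with \<open>1 / real (Suc n) \<le> 1 / real (Suc m)\<close>
      show "dist (\<phi> t x) (\<phi> (k t) p) \<le> 3 * e + 1 / Suc m" by linarith
    qed
  qed
  \<comment> \<open>Following is given for positive times only. Around a late return time
    \<open>\<tau>\<close>, where \<open>\<phi> \<tau> x\<close> is close to \<open>x\<close>, a long
    one-sided segment becomes a two-sided one about \<open>x\<close>, at the cost of
    \<open>1 / Suc n\<close>.\<close>
  have C_ne: "K \<inter> C n \<noteq> {}" for n
  proof -
    obtain \<beta> where \<beta>: "\<beta> > 0" "\<And>y z t. dist y z < \<beta> \<Longrightarrow> \<bar>t\<bar> \<le> real n \<Longrightarrow> dist (\<phi> t y) (\<phi> t z) < 1 / Suc n"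
      using flow_uniform[of "1 / Suc n" "real n"] by auto
    obtain \<tau> where \<tau>: "\<tau> \<ge> real n + 1" "dist (\<phi> \<tau> x) x < \<beta>" using recurrent[OF \<beta>(1)] by blast
    have "\<tau> + real n + 1 > 0" using \<tau> by linarith
    then obtain \<kappa> where \<kappa>: "time_change (25/16) \<kappa>"
      "\<And>t. 0 < t \<Longrightarrow> t < \<tau> + real n + 1 \<Longrightarrow> dist (\<phi> t x) (\<phi> (\<kappa> t) p) \<le> 3 * e"
      using follow by blast
    define m where "m = \<lfloor>\<kappa> \<tau> / T\<rfloor>"
    define k where "k = (\<lambda>t. \<kappa> (t + \<tau>) - of_int m * T)"
    have "of_int m \<le> \<kappa> \<tau> / T" "\<kappa> \<tau> / T < of_int m + 1" unfolding m_def by linarith+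
    then have "k 0 \<in> {0..T}" using p(1) by (simp add: k_def field_simps)
    then have "k \<in> K" unfolding K_def k_def using time_change_translate[OF \<kappa>(1)] by simp
    moreover have "k \<in> C n" unfolding C_def
    proof (intro CollectI allI impI)
      fix t :: real assume t: "\<bar>t\<bar> \<le> real n"
      then have "dist (\<phi> (t + \<tau>) x) (\<phi> (\<kappa> (t + \<tau>)) p) \<le> 3 * e" using \<tau>(1) by (intro \<kappa>(2)) auto
      moreover have "dist (\<phi> t (\<phi> \<tau> x)) (\<phi> t x) < 1 / Suc n" using \<beta>(2)[OF \<tau>(2) t] .
      ultimately show "dist (\<phi> t x) (\<phi> (k t) p) \<le> 3 * e + 1 / Suc n"
        using dist_triangle3[of "\<phi> t x" "\<phi> (k t) p" "\<phi> (t + \<tau>) x"]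
        by (simp add: k_def p_int flow_add add.commute)
    qed
    ultimately show ?thesis by blast
  qed
  have C_closed: "closed (C n)" for n
  proof -
    have "continuous_on UNIV (\<lambda>k::real \<Rightarrow> real. dist (\<phi> t x) (\<phi> (k t) p))" for t
      by (intro continuous_on_dist continuous_on_flow continuous_on_const) simp
    then have "closed (\<Inter>t\<in>{t. \<bar>t\<bar> \<le> real n}. {k::real \<Rightarrow> real. dist (\<phi> t x) (\<phi> (k t) p) \<le> 3 * e + 1 / Suc n})"
      by (intro closed_INT ballI closed_Collect_le continuous_on_const)
    moreover have "(\<Inter>t\<in>{t. \<bar>t\<bar> \<le> real n}. {k::real \<Rightarrow> real. dist (\<phi> t x) (\<phi> (k t) p) \<le> 3 * e + 1 / Suc n}) = C n"
      by (auto simp: C_def)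
    ultimately show ?thesis by simp
  qed
  have "K \<inter> (\<Inter>n. C n) \<noteq> {}"
  proof (rule compact_imp_fip_image)
    show "compact K" unfolding K_def by (rule compact_time_change) simp
    show "K \<inter> (\<Inter>n\<in>I. C n) \<noteq> {}" if "finite I" for I
    proof -
      have "C (Max (insert 0 I)) \<subseteq> (\<Inter>n\<in>I. C n)" using that by (intro INT_greatest C_mono Max_ge) auto
      then show ?thesis using C_ne[of "Max (insert 0 I)"] by blast
    qed
  qed (rule C_closed)
  then obtain k where k: "time_change (25/16) k" "\<And>n. k \<in> C n" by (auto simp: K_def)
  have "dist (\<phi> t x) (\<phi> (k t) p) \<le> 3 * e" for t
  proof (rule field_le_epsilon)
    fix \<epsilon> :: real assume "\<epsilon> > 0"
    then obtain n1 :: nat where n1: "1 / Suc n1 < \<epsilon>" using nat_approx_posE by metis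
    obtain n2 :: nat where n2: "\<bar>t\<bar> \<le> real n2" using real_arch_simple by blast
    define n where "n = max n1 n2"
    have "dist (\<phi> t x) (\<phi> (k t) p) \<le> 3 * e + 1 / Suc n"
      using k(2)[of n] n2 by (auto simp: C_def n_def)
    moreover have "1 / real (Suc n) \<le> 1 / real (Suc n1)" by (intro divide_left_mono) (auto simp: n_def)
    ultimately show "dist (\<phi> t x) (\<phi> (k t) p) \<le> 3 * e + \<epsilon>" using n1 by linarith
  qed
  then have "x \<in> orbit \<phi> p" using expansive[OF k(1), of x p] \<open>e > 0\<close> by simp
  then obtain s where s: "x = \<phi> s p" by (auto simp: orbit_flow)
  then have "\<phi> T x = \<phi> s (\<phi> T p)" by (simp add: flow_add add.commute)
  then have "\<phi> T x = x" using p(2) s by simp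
  then show False using nonperiodic[OF p(1)] by simp
qed

end

section \<open>Choice of the constants and assembly\<close>

lemma pseudo_orbit_UNIV:
  "pseudo_orbit \<phi> \<delta> T UNIV xs ts \<longleftrightarrow>
    (\<forall>i. ts i \<ge> T) \<and> (\<forall>i. dist (\<phi> (ts i) (xs i)) (xs (i + 1)) < \<delta>)"
  by (simp add: pseudo_orbit_def int_interval0_def)

lemma strongly_shadowableD:
  assumes "strongly_shadowable \<phi> x" "e > 0"
  obtains \<delta> where "\<delta> > 0" "\<And>xs ts. pseudo_orbit \<phi> \<delta> 1 UNIV xs ts \<Longrightarrow> xs 0 = x \<Longrightarrow>
    strongly_shadowed \<phi> e UNIV xs ts"
  using assms unfolding strongly_shadowable_def by meson

theorem theoremC:
  fixes \<phi> :: "real \<Rightarrow> 'a::metric_space \<Rightarrow> 'a"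
  assumes "compact (UNIV :: 'a set)"
    and "is_flow \<phi>"
    and "x \<in> NonWandering \<phi> - Crit \<phi>"
    and "strongly_shadowable \<phi> x"
    and "uniformly_expansive \<phi> x"
  shows "\<exists>Y. closed Y \<and> (\<forall>t. \<phi> t ` Y = Y) \<and>
           (\<exists>A \<Sigma> r. subshift A \<Sigma> \<and> continuous_on \<Sigma> r \<and> (\<forall>z\<in>\<Sigma>. r z > 0) \<and>
              subshift_entropy \<Sigma> > 0 \<and> conj_to_suspension \<phi> Y \<Sigma> r)"
proof -
  interpret compact_flow \<phi> using assms(1,2) by unfold_locales
  have recurrent: "\<exists>t\<ge>T. dist (\<phi> t x) x < \<epsilon>" if \<epsilon>: "\<epsilon> > 0" for \<epsilon> T
  proof -
    have "\<not> wandering \<phi> x" using assms(3) by (simp add: NonWandering_def)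
    moreover have "open (ball x \<epsilon>)" "x \<in> ball x \<epsilon>" "max T 1 > 0" using \<epsilon> by auto
    ultimately obtain t where "t \<ge> max T 1" "\<phi> t x \<in> ball x \<epsilon>"
      unfolding wandering_def by blast
    then show ?thesis by (auto simp: dist_commute)
  qed
  have nonperiodic: "\<phi> T x \<noteq> x" if "T > 0" for T
  proof
    assume "\<phi> T x = x"
    then have "\<phi> (t + T) x = \<phi> t x" for t using flow_add[of t T x] by (simp add: add.commute)
    then have "x \<in> Per \<phi>" using that by (auto simp: Per_def)
    then show False using assms(3) by (simp add: Crit_def)
  qed

  obtain U \<delta>\<^sub>U where U: "open U" "x \<in> U" "\<delta>\<^sub>U > 0"
    and exp_U: "\<And>y z h. y \<in> U \<Longrightarrow> z \<in> U \<Longrightarrow> reparam h \<Longrightarrow> (\<And>t. dist (\<phi> t y) (\<phi> (h t) z) < \<delta>\<^sub>U) \<Longrightarrow>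
      \<exists>w\<in>orbit \<phi> z. \<exists>t. y = \<phi> t w"
    using assms(5) unfolding uniformly_expansive_def by (metis zero_less_one)
  obtain \<rho> where \<rho>: "\<rho> > 0" "ball x \<rho> \<subseteq> U" using U openE by blast
  \<comment> \<open>\<open>4 * e < \<rho>\<close> keeps in \<open>U\<close> a point
    \<open>3 * e\<close>-close to one that is \<open>e\<close>-close to \<open>x\<close>;
    \<open>3 * e < \<delta>\<^sub>U\<close> triggers expansivity; 1/5 is the bound of
    \<open>Rep_inverse\<close>.\<close>
  define e where "e = min (1/5) (min (\<rho>/5) (\<delta>\<^sub>U/5))"
  have e: "e > 0" "e \<le> 1/5" "4 * e < \<rho>" "3 * e < \<delta>\<^sub>U" using \<rho> U by (auto simp: e_def min_def)
  have expansive: "y \<in> orbit \<phi> z"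
    if \<kappa>: "time_change (25/16) \<kappa>" "\<And>t. dist (\<phi> t y) (\<phi> (\<kappa> t) z) \<le> 3 * e" "dist y x \<le> e" for y z \<kappa>
  proof -
    \<comment> \<open>A reparametrization has to fix 0, so \<open>z\<close> is replaced by the point
      of its orbit that is matched with \<open>y\<close> at time 0.\<close>
    define z' where "z' = \<phi> (\<kappa> 0) z"
    have "dist x z' \<le> dist y x + dist y z'" by (rule dist_triangle3)
    moreover have "dist y z' \<le> 3 * e" using \<kappa>(2)[of 0] by (simp add: z'_def)
    ultimately have "y \<in> U" "z' \<in> U" using \<kappa>(3) e \<rho>(2) by (auto simp: dist_commute subset_iff)
    moreover have "time_change (25/16) (\<lambda>t. \<kappa> t - \<kappa> 0)" using time_change_translate[OF \<kappa>(1), of 0 "\<kappa> 0"] by simp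
    then have "reparam (\<lambda>t. \<kappa> t - \<kappa> 0)" by (rule time_change_reparam) auto
    moreover have "dist (\<phi> t y) (\<phi> (\<kappa> t - \<kappa> 0) z') < \<delta>\<^sub>U" for t
      using \<kappa>(2)[of t] e(4) by (simp add: z'_def flow_add)
    ultimately obtain w t where "w \<in> orbit \<phi> z'" "y = \<phi> t w" using exp_U by blast
    then obtain s where "y = \<phi> t (\<phi> s (\<phi> (\<kappa> 0) z))" by (auto simp: orbit_flow z'_def)
    then show ?thesis by (auto simp: orbit_flow flow_add)
  qed

  obtain d where d: "d > 0" "\<And>xs ts. pseudo_orbit \<phi> d 1 UNIV xs ts \<Longrightarrow> xs 0 = x \<Longrightarrow>
      strongly_shadowed \<phi> e UNIV xs ts"
    using strongly_shadowableD[OF assms(4) e(1)] by blast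
  \<comment> \<open>The jump size \<open>d\<close> for the coding pseudo-orbits is fixed before
    \<open>p\<close> is found, because \<open>p\<close> must lie within \<open>d / 2\<close> of
    \<open>x\<close> for changes between the two orbits to be admissible jumps. This requires
    shadowing a second time, with accuracy \<open>e'\<close>.\<close>
  define e' where "e' = min d e / 2"
  have e': "e' > 0" "e' \<le> d / 2" "e' \<le> e" "e' \<le> 1/5" using d e by (auto simp: e'_def min_def)
  obtain d' where d': "d' > 0" "\<And>xs ts. pseudo_orbit \<phi> d' 1 UNIV xs ts \<Longrightarrow> xs 0 = x \<Longrightarrow>
      strongly_shadowed \<phi> e' UNIV xs ts"
    using strongly_shadowableD[OF assms(4) e'(1)] by blast
  obtain a where a: "a \<ge> 1" "dist (\<phi> a x) x < d'" using recurrent[OF d'(1)] by blast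
  have "strongly_shadowed \<phi> e' UNIV (\<lambda>_. x) (\<lambda>_. a)"
    using a by (intro d'(2)) (auto simp: pseudo_orbit_UNIV)
  then obtain p k where k: "time_change (5/4) k" "k 0 = 0" "follows \<phi> e' (\<lambda>_. x) (\<lambda>_. a) k p"
    using strongly_shadowed_follows[OF _ e'(4)] by metis
  have "ssum (\<lambda>_. a) 1 = a" using ssum_step[of "\<lambda>_. a" 0] by simp
  then have px: "dist p x \<le> e'"
    using follows_closed_interval[OF k(3,1), of 0 0] k(2) a(1) by simp
  have k_e: "follows \<phi> e (\<lambda>_. x) (\<lambda>_. a) k p"
    using k(3) e'(3) unfolding follows_def by (meson order_trans)
  have "\<exists>T>0. \<phi> T p = p"
    by (rule loop_follower_periodic[of e x a k p]) (fact expansive a(1) e(1) k(1,2) k_e)+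
  then obtain T where T: "T > 0" "\<phi> T p = p" by blast
  have "\<exists>L>0. \<forall>\<kappa>. time_change (25/16) \<kappa> \<longrightarrow> (\<exists>t. 0 < t \<and> t < L \<and> dist (\<phi> t x) (\<phi> (\<kappa> t) p) > 3 * e)"
    by (rule recurrent_unfollowed[of e x T p]) (fact expansive recurrent nonperiodic e(1) T)+
  then obtain L where L: "L > 0" "\<And>\<kappa>. time_change (25/16) \<kappa> \<Longrightarrow> \<exists>t. 0 < t \<and> t < L \<and> dist (\<phi> t x) (\<phi> (\<kappa> t) p) > 3 * e"
    by blast
  \<comment> \<open>\<open>b \<ge> L\<close> lets the deviation from \<open>p\<close> show within
    the marker, and a return within \<open>d / 2\<close> of \<open>x\<close> ends within
    \<open>d\<close> of \<open>p\<close>.\<close>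
  obtain b where b: "b \<ge> max L 1" "dist (\<phi> b x) x < d / 2" using recurrent[of "d / 2" "max L 1"] d(1) by auto
  obtain m :: nat where m: "100 * b < real m * T" using reals_Archimedean3[OF T(1)] by blast
  \<comment> \<open>Multiples of the period bring each filler back to \<open>p\<close>;
    \<open>m\<close> makes the shortest one long enough, and the powers of 2 give the
    doubling.\<close>
  define N where "N = (\<lambda>j::nat. real m * T * 2 ^ j)"
  have N_ge: "N j \<ge> 100 * b" for j
  proof -
    have "real m * T * 1 \<le> real m * T * 2 ^ j" using T(1) by (intro mult_left_mono) auto
    then show ?thesis using m by (simp add: N_def)
  qed
  have N_mono: "N i \<le> N j" if "i \<le> j" for i j
    unfolding N_def using that T(1) by (intro mult_left_mono power_increasing) auto
  have N_double: "2 * N i \<le> N j" if "i < j" for i j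
    using N_mono[of "Suc i" j] that by (simp add: N_def)
  have N_period: "\<phi> (N j) p = p" for j
    using flow_iterate[OF T(2), of "m * 2 ^ j"] by (simp add: N_def mult_ac)
  have dur: "(if even i then b else N (z (i div 2))) \<ge> 1" for i and z :: "int \<Rightarrow> nat"
    using N_ge[of "z (i div 2)"] b(1) by auto
  interpret horseshoe \<phi> x p e b "N 3" N two_bit_shift
  proof unfold_locales
    show "compact two_bit_shift" using subshift_compact[OF two_bit_subshift] .
    show "shift ` two_bit_shift = two_bit_shift" using two_bit_subshift by (simp add: subshift_def)
    show "N (z i) \<le> N 3" if "z \<in> two_bit_shift" for z i
      using that by (intro N_mono) (simp add: two_bit_shift_def)
    show "\<exists>t>0. t < b \<and> 3 * e < dist (\<phi> t x) (\<phi> (\<kappa> t) p)" if "time_change (25/16) \<kappa>" for \<kappa>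
      using L(2)[OF that] b(1) by force
    show "\<exists>y k. time_change (5/4) k \<and> k 0 = 0 \<and> follows \<phi> e (\<lambda>i. if even i then x else p)
        (\<lambda>i. if even i then b else N (z (i div 2))) k y" for z :: "int \<Rightarrow> nat"
    proof -
      have "dist (\<phi> b x) p < d"
        using dist_triangle2[of "\<phi> b x" p x] b(2) px e'(2) by linarith
      moreover have "dist p x < d" using px e'(2) d(1) by linarith
      ultimately have "pseudo_orbit \<phi> d 1 UNIV (\<lambda>i. if even i then x else p)
          (\<lambda>i. if even i then b else N (z (i div 2)))"
        using dur by (auto simp: pseudo_orbit_UNIV N_period)
      then have "strongly_shadowed \<phi> e UNIV (\<lambda>i. if even i then x else p)
          (\<lambda>i. if even i then b else N (z (i div 2)))"
        by (rule d(2)) simp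
      then show ?thesis by (rule strongly_shadowed_follows[OF _ e(2)]) blast
    qed
    show "y' \<in> orbit \<phi> y" if "time_change (5/4) k" "k 0 = 0" "time_change (5/4) k'" "k' 0 = 0"
      "follows \<phi> e (\<lambda>i. if even i then x else p) (\<lambda>i. if even i then b else N (z (i div 2))) k y"
      "follows \<phi> e (\<lambda>i. if even i then x else p) (\<lambda>i. if even i then b else N (z (i div 2))) k' y'"
      for k k' z y y'
    proof (rule follows_same_orbit(2)[of e x "\<lambda>i. if even i then b else N (z (i div 2))"
          "\<lambda>i. if even i then x else p" k y k' y'])
      show "(if even i then b else N (z (i div 2))) \<ge> 1" for i by (rule dur)
      show "v \<in> orbit \<phi> w" if "time_change (25/16) \<kappa>" "\<And>t. dist (\<phi> t v) (\<phi> (\<kappa> t) w) \<le> 3 * e" "dist v x \<le> e"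
        for v w \<kappa> using that by (rule expansive)
    qed (use e(1) that in simp_all)
  qed (use e N_ge N_double b(1) two_bit_aperiodic in auto)
  obtain Y r where "closed Y" "\<forall>t. \<phi> t ` Y = Y" "continuous_on two_bit_shift r"
    "\<forall>z\<in>two_bit_shift. r z > 0" "conj_to_suspension \<phi> Y two_bit_shift r"
    using horseshoe_suspension by blast
  moreover have "subshift_entropy two_bit_shift > 0"
    by (rule subshift_entropy_pos[OF two_bit_subshift two_bit_words])
  ultimately show ?thesis using two_bit_subshift by blast
qed

end
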